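(* Let $f:\mathbb{R}^n\to\mathbb{R}$ be differentiable with $L_f$-Lipschitz continuous gradient, let $g:\mathbb{R}^n\to\mathbb{R}\cup\{+\infty\}$ be proper, lower semicontinuous, $\gamma_g$-prox-bounded and $\rho$-weakly convex, let $\varphi=f+g$ with $\operatorname{argmin}\varphi\neq\emptyset$. Consider the iterates generated by the PGCL algorithm described in the context, and suppose $(\bar x^k)$ converges to a strong local minimizer $x^\star$ of $\varphi$ such that $f$ is of class $C^3$ locally around $x^\star$ and $\operatorname{prox}_{\gamma g}$ is of class $C^1$ locally around $x^\star-\gamma\nabla f(x^\star)$. If for all $k$ sufficiently large $d^k=d_N^k:=-B_k^{-1}\nabla\varphi_\gamma(\bar x^k)$, then eventually $\tau_k=1$ is always accepted, and the sequences $(x^k)$, $(\bar x^k)$, $(r^k)$ converge superlinearly (to $x^\star$, $x^\star$, $0$ respectively).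
   Context: Strong local minimizer: there exist $c,\epsilon>0$ with $\varphi(x)\ge\varphi(x^\star)+c\|x-x^\star\|^2$ whenever $\|x-x^\star\|<\epsilon$. $\gamma_g$-prox-bounded: $g+\frac1{2\gamma}\|\cdot\|^2$ bounded below for each $\gamma\in(0,\gamma_g)$; $\rho$-weakly convex: $g+\frac\rho2\|\cdot\|^2$ convex. $\operatorname{prox}_{\gamma g}(x)=\operatorname{argmin}_z\{g(z)+\frac1{2\gamma}\|z-x\|^2\}$, $T_\gamma(x)=\operatorname{prox}_{\gamma g}(x-\gamma\nabla f(x))$, $R_\gamma(x)=\gamma^{-1}(x-T_\gamma(x))$. Forward-backward envelope $\varphi_\gamma(x)=\inf_u\{f(x)+\langle\nabla f(x),u-x\rangle+g(u)+\frac1{2\gamma}\|u-x\|^2\}$. $\partial_C$: Clarke generalized Jacobian. PGCL: given $x^0$, $\gamma\in(0,\min\{1/L_f,\gamma_g\})$, $\sigma\in(0,\gamma\frac{1-\gamma L_f}{2})$, $\beta\in(0,1)$, $\mu\in(0,1)$; for $k=0,1,\dots$: select $\bar x^k\in T_\gamma(x^k)$, $r^k=\gamma^{-1}(x^k-\bar x^k)$; select $\bar r^k\in R_\gamma(\bar x^k)$, $Q_k\in I-\gamma\partial_C(\nabla f)(\bar x^k)$, $P_k\in\partial_C\operatorname{prox}_{\gamma g}(\bar x^k-\gamma\nabla f(\bar x^k))$; $B_k=\gamma^{-1}Q_k(I-P_kQ_k)$; stop if $\bar r^k=0$ and $\lambda_{\min}(B_k)\ge0$; select $d^k,s^k$ with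 $\langle Q_k\bar r^k,d^k\rangle\le0$, $\langle Q_k\bar r^k,s^k\rangle\le0$, and $\langle B_ks^k,s^k\rangle<0$ if $\lambda_{\min}(B_k)<0$, $=0$ otherwise; let $\tau_k$ be the largest element of $\{\beta^m:m\in\mathbb N\}$ such that $x^{k+1}=\bar x^k+\tau_k^2d^k+\tau_ks^k$ satisfies $\varphi_\gamma(x^{k+1})\le\varphi_\gamma(x^k)-\sigma\|r^k\|^2+\frac\mu2\tau_k^2\langle B_ks^k,s^k\rangle$. *)

theory Defs
  imports "HOL-Analysis.Analysis"
begin

text \<open>Basic notions on the ambient space real^'n (R^n for an arbitrary fixed n);
  extended-real-valued functions use the type ereal (value +\<infinity> allowed).\<close>

definition proper_fun :: "('a \<Rightarrow> ereal) \<Rightarrow> bool" where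
  "proper_fun g \<longleftrightarrow> (\<forall>x. g x \<noteq> -\<infinity>) \<and> (\<exists>x. g x \<noteq> \<infinity>)"

definition lsc_fun :: "('a::topological_space \<Rightarrow> ereal) \<Rightarrow> bool" where
  "lsc_fun g \<longleftrightarrow> (\<forall>x. g x \<le> Liminf (at x) g)"

text \<open>gamma_g-prox-boundedness: g + 1/(2 gamma) norm^2 bounded below for every gamma in (0, gamma_g).\<close>
definition prox_bounded :: "ereal \<Rightarrow> ('a::real_normed_vector \<Rightarrow> ereal) \<Rightarrow> bool" where
  "prox_bounded \<gamma>g g \<longleftrightarrow>
     (\<forall>\<gamma>::real. 0 < \<gamma> \<and> ereal \<gamma> < \<gamma>g \<longrightarrow>
        (\<exists>c::real. \<forall>x. ereal c \<le> g x + ereal (norm x ^ 2 / (2 * \<gamma>))))"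

text \<open>Convexity of an extended-real-valued function (epigraph/Jensen form).\<close>
definition ereal_convex :: "('a::real_vector \<Rightarrow> ereal) \<Rightarrow> bool" where
  "ereal_convex h \<longleftrightarrow>
     (\<forall>x y. \<forall>t::real. 0 \<le> t \<and> t \<le> 1 \<longrightarrow>
        h ((1 - t) *\<^sub>R x + t *\<^sub>R y) \<le> ereal (1 - t) * h x + ereal t * h y)"

text \<open>rho-weak convexity: g + rho/2 norm^2 convex.\<close>
definition weakly_convex :: "real \<Rightarrow> ('a::real_normed_vector \<Rightarrow> ereal) \<Rightarrow> bool" where
  "weakly_convex \<rho> g \<longleftrightarrow> ereal_convex (\<lambda>x. g x + ereal (\<rho> / 2 * norm x ^ 2))"

text \<open>Proximal mapping (set-valued): prox_{gamma g}(x) = argmin_z g z + 1/(2 gamma) norm (z - x)^2.\<close>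
definition prox :: "real \<Rightarrow> ('a::real_normed_vector \<Rightarrow> ereal) \<Rightarrow> 'a \<Rightarrow> 'a set" where
  "prox \<gamma> g x = {z. \<forall>w. g z + ereal (norm (z - x) ^ 2 / (2 * \<gamma>))
                        \<le> g w + ereal (norm (w - x) ^ 2 / (2 * \<gamma>))}"

text \<open>Forward-backward operator T_gamma (set-valued); Df is the gradient of f.\<close>
definition fb_op :: "real \<Rightarrow> ('a::real_normed_vector \<Rightarrow> 'a) \<Rightarrow> ('a \<Rightarrow> ereal) \<Rightarrow> 'a \<Rightarrow> 'a set" where
  "fb_op \<gamma> Df g x = prox \<gamma> g (x - \<gamma> *\<^sub>R Df x)"

text \<open>Fixed-point residual R_gamma (set-valued).\<close>
definition fb_res :: "real \<Rightarrow> ('a::real_normed_vector \<Rightarrow> 'a) \<Rightarrow> ('a \<Rightarrow> ereal) \<Rightarrow> 'a \<Rightarrow> 'a set" where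
  "fb_res \<gamma> Df g x = (\<lambda>z. (1 / \<gamma>) *\<^sub>R (x - z)) ` fb_op \<gamma> Df g x"

text \<open>Forward-backward envelope. It is finite-valued under the standing assumptions
  (gamma below the prox-boundedness threshold, g proper), so it is taken as a real number.\<close>
definition fbe :: "real \<Rightarrow> ('a::real_inner \<Rightarrow> real) \<Rightarrow> ('a \<Rightarrow> 'a) \<Rightarrow> ('a \<Rightarrow> ereal) \<Rightarrow> 'a \<Rightarrow> real" where
  "fbe \<gamma> f Df g x = real_of_ereal
     (INF u. ereal (f x + inner (Df x) (u - x) + norm (u - x) ^ 2 / (2 * \<gamma>)) + g u)"

text \<open>Clarke generalized Jacobian of F at x: convex hull of all limits of Jacobians
  J_k of F at points y_k -> x where F is differentiable.\<close>
definition clarke_jac :: "(real^'n \<Rightarrow> real^'n) \<Rightarrow> real^'n \<Rightarrow> (real^'n^'n) set" where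
  "clarke_jac F x = convex hull
     {A. \<exists>y J. (\<forall>k. (F has_derivative (\<lambda>h. J k *v h)) (at (y k)))
               \<and> y \<longlonglongrightarrow> x \<and> J \<longlonglongrightarrow> A}"

text \<open>Clarke generalized Jacobian of a (possibly set-valued) map S, used for prox:
  the differentiability points are those near which S is single-valued, S z = {p z},
  with p differentiable there. For S = (\<lambda>z. {F z}) this is clarke_jac F.\<close>
definition clarke_jac_sv :: "(real^'n \<Rightarrow> (real^'n) set) \<Rightarrow> real^'n \<Rightarrow> (real^'n^'n) set" where
  "clarke_jac_sv S x = convex hull
     {A. \<exists>y J. (\<forall>k. \<exists>U p. open U \<and> y k \<in> U \<and> (\<forall>z\<in>U. S z = {p z})
                         \<and> (p has_derivative (\<lambda>h. J k *v h)) (at (y k)))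
               \<and> y \<longlonglongrightarrow> x \<and> J \<longlonglongrightarrow> A}"

text \<open>Real eigenvalues and smallest eigenvalue of a square matrix
  (the matrices B_k of the algorithm are symmetric).\<close>
definition real_eigenvalues :: "real^'n^'n \<Rightarrow> real set" where
  "real_eigenvalues B = {l. \<exists>v. v \<noteq> 0 \<and> B *v v = l *\<^sub>R v}"

definition lambda_min :: "real^'n^'n \<Rightarrow> real" where
  "lambda_min B = Min (real_eigenvalues B)"

text \<open>Strong local minimizer.\<close>
definition strong_local_min :: "('a::real_normed_vector \<Rightarrow> ereal) \<Rightarrow> 'a \<Rightarrow> bool" where
  "strong_local_min \<phi> xs \<longleftrightarrow> (\<exists>c>0. \<exists>\<epsilon>>0. \<forall>x. norm (x - xs) < \<epsilon> \<longrightarrow>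
       \<phi> xs + ereal (c * norm (x - xs) ^ 2) \<le> \<phi> x)"

text \<open>C^1 and C^3 on a set (derivatives as bounded linear functions, last one continuous).\<close>
definition C1_on :: "'a::real_normed_vector set \<Rightarrow> ('a \<Rightarrow> 'b::real_normed_vector) \<Rightarrow> bool" where
  "C1_on U F \<longleftrightarrow> (\<exists>D1. (\<forall>x\<in>U. (F has_derivative blinfun_apply (D1 x)) (at x))
                     \<and> continuous_on U D1)"

definition C3_on :: "'a::real_normed_vector set \<Rightarrow> ('a \<Rightarrow> 'b::real_normed_vector) \<Rightarrow> bool" where
  "C3_on U F \<longleftrightarrow> (\<exists>D1 D2 D3.
       (\<forall>x\<in>U. (F has_derivative blinfun_apply (D1 x)) (at x))
     \<and> (\<forall>x\<in>U. (D1 has_derivative blinfun_apply (D2 x)) (at x))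
     \<and> (\<forall>x\<in>U. (D2 has_derivative blinfun_apply (D3 x)) (at x))
     \<and> continuous_on U D3)"

text \<open>Q-superlinear convergence of a sequence u to a:
  u_k -> a and norm (u_{k+1} - a) = o(norm (u_k - a)).\<close>
definition superlinear_conv :: "(nat \<Rightarrow> 'a::real_normed_vector) \<Rightarrow> 'a \<Rightarrow> bool" where
  "superlinear_conv u a \<longleftrightarrow> u \<longlonglongrightarrow> a \<and>
     (\<forall>\<epsilon>>0. eventually (\<lambda>k. norm (u (Suc k) - a) \<le> \<epsilon> * norm (u k - a)) sequentially)"

end

theory Submission
  imports Defs "HOL-Library.Landau_Symbols"
begin

text \<open>
  The line search makes the forward-backward envelope \<open>\<phi>\<^sub>\<gamma>\<close> decrease by at least
  \<open>\<sigma> \<parallel>r\<^sup>k\<parallel>\<^sup>2\<close> in every iteration, and \<open>\<phi>\<^sub>\<gamma>(x\<^sup>k)\<close> dominates \<open>\<phi>(xb\<^sup>k) \<ge> min \<phi>\<close>;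
  hence \<open>r\<^sup>k \<rightarrow> 0\<close> and \<open>x\<^sup>k \<rightarrow> x\<^sup>\<star>\<close>.

  Near \<open>x\<^sup>\<star>\<close> the map \<open>T\<^sub>\<gamma>\<close> is single valued and differentiable, and \<open>\<phi>\<^sub>\<gamma>\<close> has the
  gradient \<open>Q(y)\<^sup>T R\<^sub>\<gamma>(y)\<close> with \<open>Q(y) = I - \<gamma> \<nabla>\<^sup>2f(y)\<close>. Since \<open>R\<^sub>\<gamma>(x\<^sup>\<star>) = 0\<close>, this
  gradient is differentiable at \<open>x\<^sup>\<star>\<close>, and by symmetry of the Hessian its Jacobian there is the
  matrix \<open>H = \<gamma>\<^sup>-\<^sup>1 Q (I - P Q)\<close> to which the \<open>B\<^sub>k\<close> converge. Quadratic growth of \<open>\<phi>\<close>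
  at the strong minimizer passes to \<open>\<phi>\<^sub>\<gamma>\<close> through the sufficient decrease inequality and makes
  \<open>H\<close> positive definite. Hence eventually \<open>B\<^sub>k\<close> is positive definite, \<open>s\<^sup>k = 0\<close>, and \<open>d\<^sup>k\<close>
  is a Newton step for \<open>\<nabla>\<phi>\<^sub>\<gamma>\<close>, so that \<open>xb\<^sup>k + d\<^sup>k - x\<^sup>\<star> = o(xb\<^sup>k - x\<^sup>\<star>)\<close>.
  Since \<open>\<phi>\<^sub>\<gamma>\<close> exceeds \<open>\<phi>(x\<^sup>\<star>)\<close> at most quadratically while \<open>\<phi>\<close> grows quadratically, the
  unit step then passes the line search. Finally \<open>xb\<^sup>k - x\<^sup>\<star> = O(x\<^sup>k - x\<^sup>\<star>)\<close> because
  \<open>T\<^sub>\<gamma>\<close> is Lipschitz at \<open>x\<^sup>\<star>\<close>, and \<open>x\<^sup>k - x\<^sup>\<star> = O(r\<^sup>k)\<close> because \<open>R\<^sub>\<gamma>\<close> has an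
  injective derivative there; this transfers the superlinear rate to all three sequences.
\<close>

section \<open>Coercive matrices\<close>

lemma norm_matrix_vector_mult_le:
  fixes A :: "real^'n^'m"
  shows "norm (A *v x) \<le> norm A * norm x"
proof -
  have "norm (A *v x) = L2_set (\<lambda>i. \<bar>A $ i \<bullet> x\<bar>) UNIV"
    by (simp add: norm_vec_def matrix_mult_dot L2_set_def)
  also have "\<dots> \<le> L2_set (\<lambda>i. norm (A $ i) * norm x) UNIV"
    by (rule L2_set_mono) (simp_all add: Cauchy_Schwarz_ineq2)
  also have "\<dots> = norm A * norm x"
    unfolding norm_vec_def[of A] by (simp add: L2_set_left_distrib)
  finally show ?thesis .
qed

lemma bounded_bilinear_matrix_matrix_mult:
  "bounded_bilinear ((**) :: real^'n^'m \<Rightarrow> real^'k^'n \<Rightarrow> real^'k^'m)"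
  unfolding bilinear_conv_bounded_bilinear[symmetric] bilinear_def
  by (auto intro!: linearI simp: matrix_matrix_mult_def vec_eq_iff sum.distrib sum_distrib_left
      algebra_simps)

lemmas tendsto_matrix_matrix_mult [tendsto_intros] =
  bounded_bilinear.tendsto[OF bounded_bilinear_matrix_matrix_mult]

lemma coercive_matrix_le_norm:
  fixes B :: "real^'n^'n"
  assumes "\<And>h. c * (norm h)\<^sup>2 \<le> h \<bullet> (B *v h)"
  shows "c * norm u \<le> norm (B *v u)"
proof (cases "u = 0")
  case False
  have "norm u * (c * norm u) \<le> norm u * norm (B *v u)"
    using assms[of u] Cauchy_Schwarz_ineq2[of u "B *v u"] by (simp add: power2_eq_square ac_simps)
  then show ?thesis using False by simp
qed simp

lemma coercive_matrix_inv_right: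
  fixes B :: "real^'n^'n"
  assumes "\<And>h. c * (norm h)\<^sup>2 \<le> h \<bullet> (B *v h)" and "0 < c"
  shows "B *v (matrix_inv B *v v) = v"
proof -
  have "x = 0" if "B *v x = 0" for x
    using coercive_matrix_le_norm[OF assms(1), of x] assms(2) that by (simp add: mult_le_0_iff)
  then have "invertible B"
    using matrix_left_invertible_ker matrix_left_right_inverse invertible_def by metis
  then show ?thesis
    unfolding invertible_def matrix_inv_def
    by (metis (mono_tags, lifting) someI matrix_vector_mul_assoc matrix_vector_mul_lid)
qed

lemma coercive_matrix_perturb:
  fixes B H :: "real^'n^'n"
  assumes "\<And>h. c * (norm h)\<^sup>2 \<le> h \<bullet> (H *v h)"
  shows "(c - norm (B - H)) * (norm h)\<^sup>2 \<le> h \<bullet> (B *v h)"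
proof -
  have "\<bar>h \<bullet> ((B - H) *v h)\<bar> \<le> norm h * norm ((B - H) *v h)"
    by (rule Cauchy_Schwarz_ineq2)
  also have "\<dots> \<le> norm h * (norm (B - H) * norm h)"
    by (intro mult_left_mono norm_matrix_vector_mult_le) simp
  finally have "\<bar>h \<bullet> ((B - H) *v h)\<bar> \<le> norm (B - H) * (norm h)\<^sup>2"
    by (simp add: power2_eq_square ac_simps)
  moreover have "h \<bullet> (B *v h) = h \<bullet> (H *v h) + h \<bullet> ((B - H) *v h)"
    by (simp add: matrix_vector_mult_diff_rdistrib inner_diff_right)
  ultimately show ?thesis
    using assms[of h] by (simp add: left_diff_distrib abs_le_iff)
qed

lemma inner_transpose_matrix_vector:
  fixes A :: "real^'n^'n"
  shows "h \<bullet> (transpose A *v v) = (A *v h) \<bullet> v"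
  unfolding transpose_matrix_vector by (metis dot_lmul_matrix inner_commute)

lemma norm_add_squared_weighted_le:
  fixes a b :: "'a::real_normed_vector"
  assumes "0 \<le> \<alpha>" and "0 \<le> \<beta>"
  shows "min \<alpha> \<beta> / 2 * (norm (a + b))\<^sup>2 \<le> \<alpha> * (norm a)\<^sup>2 + \<beta> * (norm b)\<^sup>2"
proof -
  have "(norm (a + b))\<^sup>2 \<le> (norm a + norm b)\<^sup>2"
    by (simp add: norm_triangle_ineq power_mono)
  also have "\<dots> \<le> 2 * (norm a)\<^sup>2 + 2 * (norm b)\<^sup>2"
    using sum_squares_bound[of "norm a" "norm b"] by (simp add: power2_eq_square algebra_simps)
  finally have "min \<alpha> \<beta> / 2 * (norm (a + b))\<^sup>2 \<le> min \<alpha> \<beta> / 2 * (2 * (norm a)\<^sup>2 + 2 * (norm b)\<^sup>2)"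
    using assms by (intro mult_left_mono) simp_all
  also have "\<dots> = min \<alpha> \<beta> * (norm a)\<^sup>2 + min \<alpha> \<beta> * (norm b)\<^sup>2"
    by (simp add: algebra_simps)
  also have "\<dots> \<le> \<alpha> * (norm a)\<^sup>2 + \<beta> * (norm b)\<^sup>2"
    by (intro add_mono mult_right_mono) simp_all
  finally show ?thesis .
qed

section \<open>Differential calculus\<close>

lemma has_real_derivative_along_line:
  fixes F :: "'a::real_normed_vector \<Rightarrow> real"
  assumes "(F has_derivative D) (at (x + t *\<^sub>R v))"
  shows "((\<lambda>t. F (x + t *\<^sub>R v)) has_real_derivative D v) (at t)"
proof -
  have "((\<lambda>t. x + t *\<^sub>R v) has_derivative (\<lambda>s. s *\<^sub>R v)) (at t)"
    by (auto intro!: derivative_eq_intros)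
  from has_derivative_compose[OF this assms]
  have "((\<lambda>t. F (x + t *\<^sub>R v)) has_derivative (\<lambda>s. D (s *\<^sub>R v))) (at t)"
    by (simp add: o_def)
  moreover have "linear D" using assms has_derivative_linear by blast
  ultimately have "((\<lambda>t. F (x + t *\<^sub>R v)) has_derivative (\<lambda>s. s * D v)) (at t)"
    by (simp add: linear_cmul)
  then show ?thesis
    unfolding has_field_derivative_def by (rule has_derivative_eq_rhs) (simp add: fun_eq_iff)
qed

lemma
  fixes f :: "'a::real_inner \<Rightarrow> real"
  assumes grad: "\<And>y. GDERIV f y :> Df y" and lip: "L-lipschitz_on UNIV Df"
  shows lipschitz_gradient_upper_bound: "f u \<le> f x + Df x \<bullet> (u - x) + L / 2 * (norm (u - x))\<^sup>2"
    and lipschitz_gradient_lower_bound: "f x + Df x \<bullet> (u - x) - L / 2 * (norm (u - x))\<^sup>2 \<le> f u"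
proof -
  define v where "v = u - x"
  define \<phi> where "\<phi> t = f (x + t *\<^sub>R v) - t * (Df x \<bullet> v)" for t
  have \<phi>_deriv: "(\<phi> has_real_derivative (Df (x + t *\<^sub>R v) - Df x) \<bullet> v) (at t)" for t
  proof -
    have "(f has_derivative (\<lambda>h. h \<bullet> Df (x + t *\<^sub>R v))) (at (x + t *\<^sub>R v))"
      using grad by (simp add: gderiv_def)
    from has_real_derivative_along_line[OF this] show ?thesis
      unfolding \<phi>_def by (auto intro!: derivative_eq_intros simp: inner_commute inner_diff_right)
  qed
  have \<phi>_deriv_bound: "\<bar>(Df (x + t *\<^sub>R v) - Df x) \<bullet> v\<bar> \<le> L * t * (norm v)\<^sup>2" if "0 \<le> t" for t
  proof -
    have "\<bar>(Df (x + t *\<^sub>R v) - Df x) \<bullet> v\<bar> \<le> norm (Df (x + t *\<^sub>R v) - Df x) * norm v"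
      by (rule Cauchy_Schwarz_ineq2)
    also have "\<dots> \<le> L * norm (t *\<^sub>R v) * norm v"
      using lipschitz_onD[OF lip, of "x + t *\<^sub>R v" x] by (simp add: dist_norm mult_right_mono)
    also have "\<dots> = L * t * (norm v)\<^sup>2"
      using that by (simp add: power2_eq_square)
    finally show ?thesis .
  qed
  have "\<phi> 1 - L / 2 * 1\<^sup>2 * (norm v)\<^sup>2 \<le> \<phi> 0 - L / 2 * 0\<^sup>2 * (norm v)\<^sup>2"
    by (rule DERIV_nonpos_imp_nonincreasing[where f = "\<lambda>t. \<phi> t - L / 2 * t\<^sup>2 * (norm v)\<^sup>2"])
      (auto intro!: exI derivative_eq_intros \<phi>_deriv dest!: \<phi>_deriv_bound simp: abs_le_iff mult_ac)
  then show "f u \<le> f x + Df x \<bullet> (u - x) + L / 2 * (norm (u - x))\<^sup>2"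
    by (simp add: \<phi>_def v_def)
  have "\<phi> 0 + L / 2 * 0\<^sup>2 * (norm v)\<^sup>2 \<le> \<phi> 1 + L / 2 * 1\<^sup>2 * (norm v)\<^sup>2"
    by (rule DERIV_nonneg_imp_nondecreasing[where f = "\<lambda>t. \<phi> t + L / 2 * t\<^sup>2 * (norm v)\<^sup>2"])
      (auto intro!: exI derivative_eq_intros \<phi>_deriv dest!: \<phi>_deriv_bound simp: abs_le_iff mult_ac)
  then show "f x + Df x \<bullet> (u - x) - L / 2 * (norm (u - x))\<^sup>2 \<le> f u"
    by (simp add: \<phi>_def v_def)
qed

lemma has_derivative_squeeze:
  fixes F U :: "'a::real_normed_vector \<Rightarrow> real"
  assumes U: "(U has_derivative D) (at y)"
    and bounds: "eventually (\<lambda>z. U z - U y + E z \<le> F z - F y \<and> F z - F y \<le> U z - U y) (at y)"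
    and E: "((\<lambda>z. E z / norm (z - y)) \<longlongrightarrow> 0) (at y)"
  shows "(F has_derivative D) (at y)"
proof -
  have D: "bounded_linear D"
    and U_lim: "((\<lambda>z. norm (U z - U y - D (z - y)) / norm (z - y)) \<longlongrightarrow> 0) (at y)"
    using U by (simp_all add: has_derivative_iff_norm)
  have "((\<lambda>z. norm (F z - F y - D (z - y)) / norm (z - y)) \<longlongrightarrow> 0) (at y)"
  proof (rule tendsto_sandwich[of "\<lambda>_. 0" _ _ "\<lambda>z. norm (U z - U y - D (z - y)) / norm (z - y) + \<bar>E z / norm (z - y)\<bar>"])
    show "eventually (\<lambda>z. norm (F z - F y - D (z - y)) / norm (z - y)
        \<le> norm (U z - U y - D (z - y)) / norm (z - y) + \<bar>E z / norm (z - y)\<bar>) (at y)"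
      using bounds
    proof eventually_elim
      case (elim z)
      then have "\<bar>F z - F y - D (z - y)\<bar> \<le> \<bar>U z - U y - D (z - y)\<bar> + \<bar>E z\<bar>"
        by linarith
      then show ?case
        by (simp add: add_divide_distrib[symmetric] divide_right_mono)
    qed
    show "((\<lambda>z. norm (U z - U y - D (z - y)) / norm (z - y) + \<bar>E z / norm (z - y)\<bar>) \<longlongrightarrow> 0) (at y)"
      using tendsto_add[OF U_lim tendsto_rabs_zero[OF E]] by simp
  qed auto
  with D show ?thesis
    by (simp add: has_derivative_iff_norm)
qed

lemma has_derivative_matrix_mult_vanishing:
  fixes R :: "'a::euclidean_space \<Rightarrow> real^'n" and M :: "'a \<Rightarrow> real^'n^'m"
  assumes R: "(R has_derivative (\<lambda>h. A h)) (at x)" and "R x = 0" and M: "isCont M x"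
  shows "((\<lambda>y. M y *v R y) has_derivative (\<lambda>h. M x *v A h)) (at x)"
proof -
  have A: "bounded_linear A"
    using R by (rule has_derivative_bounded_linear)
  then obtain K where K: "\<And>h. norm (A h) \<le> norm h * K"
    using bounded_linear.bounded by blast
  define \<rho> where "\<rho> y = norm (R y - R x - A (y - x)) / norm (y - x)" for y
  have \<rho>: "(\<rho> \<longlongrightarrow> 0) (at x)"
    using R unfolding \<rho>_def has_derivative_iff_norm by blast
  have bound: "norm (M y *v R y - M x *v R x - M x *v A (y - x)) / norm (y - x)
      \<le> norm (M y) * \<rho> y + norm (M y - M x) * \<bar>K\<bar>" for y
  proof -
    have "M y *v R y - M x *v R x - M x *v A (y - x)
        = M y *v (R y - R x - A (y - x)) + (M y - M x) *v A (y - x)"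
      using \<open>R x = 0\<close> by (simp add: matrix_vector_mult_diff_distrib matrix_vector_mult_diff_rdistrib)
    then have "norm (M y *v R y - M x *v R x - M x *v A (y - x))
        \<le> norm (M y *v (R y - R x - A (y - x))) + norm ((M y - M x) *v A (y - x))"
      by (simp add: norm_triangle_ineq)
    also have "\<dots> \<le> norm (M y) * norm (R y - R x - A (y - x)) + norm (M y - M x) * norm (A (y - x))"
      by (intro add_mono norm_matrix_vector_mult_le)
    also have "\<dots> \<le> norm (M y) * norm (R y - R x - A (y - x)) + norm (M y - M x) * (norm (y - x) * \<bar>K\<bar>)"
      using K[of "y - x"] by (intro add_mono mult_left_mono order_trans[OF _ mult_left_mono[OF abs_ge_self]]) auto
    finally have "norm (M y *v R y - M x *v R x - M x *v A (y - x))
        \<le> norm (M y) * norm (R y - R x - A (y - x)) + norm (M y - M x) * (norm (y - x) * \<bar>K\<bar>)" .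
    then have "norm (M y *v R y - M x *v R x - M x *v A (y - x)) / norm (y - x)
        \<le> (norm (M y) * norm (R y - R x - A (y - x)) + norm (M y - M x) * (norm (y - x) * \<bar>K\<bar>)) / norm (y - x)"
      by (rule divide_right_mono) simp
    also have "\<dots> = norm (M y) * \<rho> y + norm (M y - M x) * \<bar>K\<bar>"
      unfolding \<rho>_def by (cases "y = x") (simp_all add: add_divide_distrib)
    finally show ?thesis .
  qed
  have "((\<lambda>y. norm (M y) * \<rho> y + norm (M y - M x) * \<bar>K\<bar>) \<longlongrightarrow> norm (M x) * 0 + norm (M x - M x) * \<bar>K\<bar>) (at x)"
    using M \<rho> unfolding isCont_def by (intro tendsto_intros)
  then have lim: "((\<lambda>y. norm (M y) * \<rho> y + norm (M y - M x) * \<bar>K\<bar>) \<longlongrightarrow> 0) (at x)"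
    by simp
  have "((\<lambda>y. norm (M y *v R y - M x *v R x - M x *v A (y - x)) / norm (y - x)) \<longlongrightarrow> 0) (at x)"
    by (rule Lim_null_comparison[OF always_eventually lim]) (simp add: bound)
  with A show ?thesis
    by (simp add: has_derivative_iff_norm bounded_linear_compose[OF matrix_vector_mul_bounded_linear])
qed

lemma has_derivative_imp_lipschitz_at:
  assumes "(F has_derivative F') (at x)"
  obtains C where "eventually (\<lambda>y. norm (F y - F x) \<le> C * norm (y - x)) (nhds x)"
proof -
  obtain K where K: "\<And>h. norm (F' h) \<le> norm h * K"
    using assms has_derivative_bounded_linear bounded_linear.bounded by blast
  obtain \<delta> where "0 < \<delta>" and \<delta>: "\<And>y. norm (y - x) < \<delta> \<Longrightarrow> norm (F y - F x - F' (y - x)) \<le> 1 * norm (y - x)"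
    using assms unfolding has_derivative_at_alt by (meson zero_less_one)
  have "norm (F y - F x) \<le> (K + 1) * norm (y - x)" if "norm (y - x) < \<delta>" for y
  proof -
    have "(K + 1) * norm (y - x) = norm (y - x) * K + 1 * norm (y - x)"
      by (simp add: algebra_simps)
    then show ?thesis
      using norm_triangle_sub[of "F y - F x" "F' (y - x)"] \<delta>[OF that] K[of "y - x"] by linarith
  qed
  with \<open>0 < \<delta>\<close> have "eventually (\<lambda>y. norm (F y - F x) \<le> (K + 1) * norm (y - x)) (nhds x)"
    unfolding eventually_nhds_metric dist_norm by blast
  then show ?thesis
    by (rule that)
qed

lemma has_derivative_injective_lower_bound:
  assumes "(F has_derivative F') (at x)" and "0 < c" and "\<And>h. c * norm h \<le> norm (F' h)"
  shows "eventually (\<lambda>y. c / 2 * norm (y - x) \<le> norm (F y - F x)) (nhds x)"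
proof -
  obtain \<delta> where "0 < \<delta>" and \<delta>: "\<And>y. norm (y - x) < \<delta> \<Longrightarrow> norm (F y - F x - F' (y - x)) \<le> c / 2 * norm (y - x)"
    using assms(1,2) unfolding has_derivative_at_alt by (meson half_gt_zero)
  have "c / 2 * norm (y - x) \<le> norm (F y - F x)" if "norm (y - x) < \<delta>" for y
    using norm_triangle_sub[of "F' (y - x)" "F y - F x"] \<delta>[OF that] assms(3)[of "y - x"]
      norm_minus_commute[of "F' (y - x)" "F y - F x"]
    by linarith
  with \<open>0 < \<delta>\<close> show ?thesis
    unfolding eventually_nhds_metric dist_norm by blast
qed

lemma gderiv_unique:
  assumes "GDERIV F x :> a" and "GDERIV F x :> b"
  shows "a = b"
proof -
  have "(\<lambda>h. h \<bullet> a) = (\<lambda>h. h \<bullet> b)"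
    using assms unfolding gderiv_def by (rule has_derivative_unique)
  then have "(a - b) \<bullet> a = (a - b) \<bullet> b"
    by meson
  then have "(a - b) \<bullet> (a - b) = 0"
    by (simp add: inner_diff_right)
  then show ?thesis
    by simp
qed

lemma continuous_jacobian_close:
  fixes J :: "'a::metric_space \<Rightarrow> 'm::real_normed_vector"
  assumes "eventually P (nhds x0)" and "isCont J x0" and "0 < e"
  shows "\<exists>d>0. \<forall>y. dist y x0 < d \<longrightarrow> P y \<and> dist (J y) (J x0) \<le> e"
proof -
  have "eventually (\<lambda>y. dist (J y) (J x0) < e) (nhds x0)"
    using tendstoD[OF assms(2)[unfolded isCont_def tendsto_at_iff_tendsto_nhds] assms(3)] .
  with assms(1) have "eventually (\<lambda>y. P y \<and> dist (J y) (J x0) < e) (nhds x0)"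
    by (rule eventually_conj)
  then show ?thesis
    unfolding eventually_nhds_metric by (fastforce simp: dist_commute)
qed

lemma C1_on_imp_continuous_jacobian:
  fixes p :: "real^'n \<Rightarrow> real^'m"
  assumes "C1_on U p"
  obtains J where "\<And>y. y \<in> U \<Longrightarrow> (p has_derivative (*v) (J y)) (at y)" and "continuous_on U J"
proof -
  obtain D where D: "\<And>y. y \<in> U \<Longrightarrow> (p has_derivative blinfun_apply (D y)) (at y)"
    and cont: "continuous_on U D"
    using assms unfolding C1_on_def by blast
  show ?thesis
  proof
    show "(p has_derivative (*v) (matrix (D y))) (at y)" if "y \<in> U" for y
      using D[OF that] matrix_vector_mul(3)[OF blinfun.bounded_linear_right, of "D y"] by simp
    show "continuous_on U (\<lambda>y. matrix (D y))"
      unfolding matrix_def by (intro continuous_intros cont)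
  qed
qed

lemma C3_on_imp_C1_on_gradient:
  fixes f :: "real^'n \<Rightarrow> real"
  assumes grad: "\<And>y. GDERIV f y :> Df y" and U: "open U" and f: "C3_on U f"
  shows "C1_on U Df"
proof -
  obtain D1 D2 D3 where D1: "\<And>y. y \<in> U \<Longrightarrow> (f has_derivative blinfun_apply (D1 y)) (at y)"
    and D2: "\<And>y. y \<in> U \<Longrightarrow> (D1 has_derivative blinfun_apply (D2 y)) (at y)"
    and D3: "\<And>y. y \<in> U \<Longrightarrow> (D2 has_derivative blinfun_apply (D3 y)) (at y)"
    using f unfolding C3_on_def by blast
  define G :: "((real^'n) \<Rightarrow>\<^sub>L real) \<Rightarrow> real^'n" where "G b = (\<Sum>i\<in>UNIV. b (axis i 1) *\<^sub>R axis i 1)" for b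
  have G: "bounded_linear G"
    unfolding G_def by (intro bounded_linear_intros)
  have Df_eq: "Df y = G (D1 y)" if "y \<in> U" for y
  proof -
    have "blinfun_apply (D1 y) = (\<lambda>h. h \<bullet> Df y)"
      using has_derivative_unique D1[OF that] grad[of y] unfolding gderiv_def by blast
    then show ?thesis
      by (simp add: G_def inner_axis' scalar_mult_eq_scaleR[symmetric] basis_expansion)
  qed
  show ?thesis
    unfolding C1_on_def
  proof (intro exI conjI ballI)
    show "(Df has_derivative blinfun_apply (Blinfun G o\<^sub>L D2 y)) (at y)" if "y \<in> U" for y
    proof (rule has_derivative_transform_within_open[OF _ U that])
      show "((\<lambda>y. G (D1 y)) has_derivative blinfun_apply (Blinfun G o\<^sub>L D2 y)) (at y)"
        using bounded_linear.has_derivative[OF G D2[OF that]]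
        by (rule has_derivative_eq_rhs) (simp add: fun_eq_iff bounded_linear_Blinfun_apply[OF G])
    qed (simp add: Df_eq)
    have "continuous_on U D2"
      using D3 by (intro has_derivative_continuous_on) (auto intro: has_derivative_at_withinI)
    then show "continuous_on U (\<lambda>y. Blinfun G o\<^sub>L D2 y)"
      by (intro continuous_intros)
  qed
qed

lemma second_difference_mean_value:
  fixes f :: "real^'n \<Rightarrow> real"
  assumes grad: "\<And>y. GDERIV f y :> Df y"
    and hess: "\<And>s t. 0 \<le> s \<Longrightarrow> s \<le> 1 \<Longrightarrow> 0 \<le> t \<Longrightarrow> t \<le> 1 \<Longrightarrow>
       (Df has_derivative (*v) (J (q + s *\<^sub>R h + t *\<^sub>R k))) (at (q + s *\<^sub>R h + t *\<^sub>R k))"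
  obtains s t where "0 \<le> s" "s \<le> 1" "0 \<le> t" "t \<le> 1"
    and "f (q + h + k) - f (q + h) - f (q + k) + f q = (J (q + s *\<^sub>R h + t *\<^sub>R k) *v k) \<bullet> h"
proof -
  have f': "(f has_derivative (\<lambda>v. v \<bullet> Df y)) (at y)" for y
    using grad by (simp add: gderiv_def)
  define \<phi> where "\<phi> s = f (q + k + s *\<^sub>R h) - f (q + s *\<^sub>R h)" for s
  have d\<phi>: "(\<phi> has_real_derivative Df (q + k + s *\<^sub>R h) \<bullet> h - Df (q + s *\<^sub>R h) \<bullet> h) (at s)" for s
    unfolding \<phi>_def
    using has_real_derivative_along_line[OF f'[of "q + k + s *\<^sub>R h"]]
      has_real_derivative_along_line[OF f'[of "q + s *\<^sub>R h"]]
    by (intro DERIV_diff) (simp_all add: inner_commute)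
  obtain s where s: "0 < s" "s < 1"
    and s_eq: "\<phi> 1 - \<phi> 0 = (1 - 0) * (Df (q + k + s *\<^sub>R h) \<bullet> h - Df (q + s *\<^sub>R h) \<bullet> h)"
    using MVT2[OF zero_less_one d\<phi>] by blast
  define \<psi> where "\<psi> t = Df (q + s *\<^sub>R h + t *\<^sub>R k) \<bullet> h" for t
  have d\<psi>: "(\<psi> has_real_derivative (J (q + s *\<^sub>R h + t *\<^sub>R k) *v k) \<bullet> h) (at t)" if "0 \<le> t" "t \<le> 1" for t
    unfolding \<psi>_def using hess[of s t] s that
    by (intro has_real_derivative_along_line[where F = "\<lambda>y. Df y \<bullet> h"]) (auto intro!: derivative_eq_intros)
  obtain t where t: "0 < t" "t < 1"
    and t_eq: "\<psi> 1 - \<psi> 0 = (1 - 0) * ((J (q + s *\<^sub>R h + t *\<^sub>R k) *v k) \<bullet> h)"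
    using MVT2[OF zero_less_one d\<psi>] by blast
  have "f (q + h + k) - f (q + h) - f (q + k) + f q = \<phi> 1 - \<phi> 0"
    by (simp add: \<phi>_def algebra_simps)
  also have "\<dots> = \<psi> 1 - \<psi> 0"
    unfolding s_eq by (simp add: \<psi>_def algebra_simps)
  finally show ?thesis
    using that[of s t] s t t_eq by simp
qed

lemma second_difference_hessian_estimate:
  fixes f :: "real^'n \<Rightarrow> real"
  assumes grad: "\<And>y. GDERIV f y :> Df y"
    and hess: "\<And>y. dist y x0 < d \<Longrightarrow> (Df has_derivative (*v) (J y)) (at y)"
    and close: "\<And>y. dist y x0 < d \<Longrightarrow> dist (J y) (J x0) \<le> e"
    and hk: "norm h + norm k < d"
  shows "\<bar>f (x0 + h + k) - f (x0 + h) - f (x0 + k) + f x0 - (J x0 *v k) \<bullet> h\<bar> \<le> e * (norm h * norm k)"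
proof -
  have near: "dist (x0 + s *\<^sub>R h + t *\<^sub>R k) x0 < d" if "0 \<le> s" "s \<le> 1" "0 \<le> t" "t \<le> 1" for s t
  proof -
    have "dist (x0 + s *\<^sub>R h + t *\<^sub>R k) x0 \<le> norm (s *\<^sub>R h) + norm (t *\<^sub>R k)"
      unfolding dist_norm add_diff_cancel_left' add.assoc by (rule norm_triangle_ineq)
    also have "\<dots> \<le> norm h + norm k"
      using that by (intro add_mono) (simp_all add: mult_left_le_one_le)
    finally show ?thesis
      using hk by simp
  qed
  obtain s t where st: "0 \<le> s" "s \<le> 1" "0 \<le> t" "t \<le> 1"
    and mvt: "f (x0 + h + k) - f (x0 + h) - f (x0 + k) + f x0 = (J (x0 + s *\<^sub>R h + t *\<^sub>R k) *v k) \<bullet> h"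
    using second_difference_mean_value[OF grad hess[OF near]] by blast
  define z where "z = x0 + s *\<^sub>R h + t *\<^sub>R k"
  have "\<bar>(J z *v k) \<bullet> h - (J x0 *v k) \<bullet> h\<bar> = \<bar>((J z - J x0) *v k) \<bullet> h\<bar>"
    by (simp add: matrix_vector_mult_diff_rdistrib inner_diff_left)
  also have "\<dots> \<le> norm ((J z - J x0) *v k) * norm h"
    by (rule Cauchy_Schwarz_ineq2)
  also have "\<dots> \<le> norm (J z - J x0) * norm k * norm h"
    by (intro mult_right_mono norm_matrix_vector_mult_le) simp
  also have "\<dots> \<le> e * norm k * norm h"
    using close[OF near[OF st]] by (intro mult_right_mono) (simp_all add: z_def dist_norm)
  finally show ?thesis
    using mvt by (simp add: z_def ac_simps)
qed

lemma hessian_asymmetry_bound: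
  fixes f :: "real^'n \<Rightarrow> real"
  assumes grad: "\<And>y. GDERIV f y :> Df y"
    and hess: "eventually (\<lambda>y. (Df has_derivative (*v) (J y)) (at y)) (nhds x0)"
    and cont: "isCont J x0" and "0 < e"
  shows "\<bar>(J x0 *v k) \<bullet> h - (J x0 *v h) \<bullet> k\<bar> \<le> e * (2 * (norm h * norm k))"
proof -
  obtain d where "0 < d" and d: "\<And>y. dist y x0 < d \<Longrightarrow> (Df has_derivative (*v) (J y)) (at y)"
    and d': "\<And>y. dist y x0 < d \<Longrightarrow> dist (J y) (J x0) \<le> e"
    using continuous_jacobian_close[OF hess cont \<open>0 < e\<close>] by blast
  define X where "X = norm h + norm k + 1"
  define t where "t = d / (2 * X)"
  have "0 < X"
    by (simp add: X_def add_nonneg_pos)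
  then have "0 < t" and "t * X = d / 2"
    using \<open>0 < d\<close> by (simp_all add: t_def)
  then have small: "norm (t *\<^sub>R h) + norm (t *\<^sub>R k) < d"
    using \<open>0 < d\<close> by (simp add: X_def algebra_simps)
  have small': "norm (t *\<^sub>R k) + norm (t *\<^sub>R h) < d"
    using small by simp
  have "\<bar>f (x0 + t *\<^sub>R h + t *\<^sub>R k) - f (x0 + t *\<^sub>R h) - f (x0 + t *\<^sub>R k) + f x0
      - (J x0 *v (t *\<^sub>R k)) \<bullet> (t *\<^sub>R h)\<bar> \<le> e * (norm (t *\<^sub>R h) * norm (t *\<^sub>R k))"
    by (rule second_difference_hessian_estimate[OF grad d d' small])
  moreover have "\<bar>f (x0 + t *\<^sub>R k + t *\<^sub>R h) - f (x0 + t *\<^sub>R k) - f (x0 + t *\<^sub>R h) + f x0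
      - (J x0 *v (t *\<^sub>R h)) \<bullet> (t *\<^sub>R k)\<bar> \<le> e * (norm (t *\<^sub>R k) * norm (t *\<^sub>R h))"
    by (rule second_difference_hessian_estimate[OF grad d d' small'])
  moreover have "x0 + t *\<^sub>R k + t *\<^sub>R h = x0 + t *\<^sub>R h + t *\<^sub>R k"
    by (simp add: algebra_simps)
  moreover have "(J x0 *v (t *\<^sub>R v)) \<bullet> (t *\<^sub>R w) = t * (t * ((J x0 *v v) \<bullet> w))" for v w
    by (simp add: matrix_vector_mult_scaleR)
  ultimately have "\<bar>t * (t * ((J x0 *v k) \<bullet> h)) - t * (t * ((J x0 *v h) \<bullet> k))\<bar>
      \<le> 2 * (e * (norm (t *\<^sub>R h) * norm (t *\<^sub>R k)))"
    unfolding abs_le_iff by (simp only: mult.commute[of "norm (t *\<^sub>R k)"]) linarith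
  also have "\<dots> = t * (t * (e * (2 * (norm h * norm k))))"
    using \<open>0 < t\<close> by (simp add: algebra_simps)
  finally show ?thesis
    using \<open>0 < t\<close> by (simp add: abs_mult flip: right_diff_distrib)
qed

lemma hessian_symmetric:
  fixes f :: "real^'n \<Rightarrow> real"
  assumes grad: "\<And>y. GDERIV f y :> Df y"
    and hess: "eventually (\<lambda>y. (Df has_derivative (*v) (J y)) (at y)) (nhds x0)"
    and cont: "isCont J x0"
  shows "transpose (J x0) = J x0"
proof -
  have sym: "(J x0 *v k) \<bullet> h = (J x0 *v h) \<bullet> k" for h k
  proof -
    define C where "C = 2 * (norm h * norm k) + 1"
    have "0 < C"
      by (simp add: C_def add_nonneg_pos)
    have "\<bar>(J x0 *v k) \<bullet> h - (J x0 *v h) \<bullet> k\<bar> \<le> 0 + e" if "0 < e" for e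
    proof -
      have "\<bar>(J x0 *v k) \<bullet> h - (J x0 *v h) \<bullet> k\<bar> \<le> e / C * (2 * (norm h * norm k))"
        using hessian_asymmetry_bound[OF grad hess cont, of "e / C"] \<open>0 < C\<close> that by simp
      also have "\<dots> \<le> e"
        using \<open>0 < C\<close> that by (simp add: C_def field_simps)
      finally show ?thesis
        by simp
    qed
    then show ?thesis
      using field_le_epsilon[of "\<bar>(J x0 *v k) \<bullet> h - (J x0 *v h) \<bullet> k\<bar>" 0] by simp
  qed
  have entry: "A $ i $ j = (A *v axis j 1) \<bullet> axis i 1" for A :: "real^'n^'n" and i j
    by (simp add: inner_axis matrix_vector_mul_component)
  show ?thesis
    by (simp add: vec_eq_iff transpose_def) (metis entry sym)
qed

lemma gradient_mean_value_along_ray: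
  fixes \<phi> :: "'a::real_inner \<Rightarrow> real"
  assumes "0 < t" and grad: "\<And>s. 0 \<le> s \<Longrightarrow> s \<le> t \<Longrightarrow> GDERIV \<phi> (x + s *\<^sub>R h) :> G (x + s *\<^sub>R h)"
  obtains z where "0 < z" "z < t" "\<phi> (x + t *\<^sub>R h) - \<phi> x = t * (G (x + z *\<^sub>R h) \<bullet> h)"
proof -
  have "\<exists>z>0. z < t \<and> \<phi> (x + t *\<^sub>R h) - \<phi> (x + 0 *\<^sub>R h) = (t - 0) * (G (x + z *\<^sub>R h) \<bullet> h)"
  proof (rule MVT2[OF \<open>0 < t\<close>])
    fix s assume "0 \<le> s" "s \<le> t"
    then have "(\<phi> has_derivative (\<lambda>v. v \<bullet> G (x + s *\<^sub>R h))) (at (x + s *\<^sub>R h))"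
      using grad by (simp add: gderiv_def)
    then show "((\<lambda>s. \<phi> (x + s *\<^sub>R h)) has_real_derivative G (x + s *\<^sub>R h) \<bullet> h) (at s)"
      using has_real_derivative_along_line by (simp add: inner_commute)
  qed
  then show ?thesis
    using that by auto
qed

lemma has_derivative_along_ray_bound:
  fixes G :: "real^'n \<Rightarrow> real^'n"
  assumes G: "(G has_derivative (*v) H) (at x0)" and "G x0 = 0" and "0 < \<epsilon>" and "h \<noteq> 0"
  obtains d where "0 < d" "\<And>z. 0 < z \<Longrightarrow> z * norm h < d \<Longrightarrow> G (x0 + z *\<^sub>R h) \<bullet> h \<le> z * (h \<bullet> (H *v h) + \<epsilon>)"
proof -
  define e where "e = \<epsilon> / (norm h)\<^sup>2"
  have "0 < e"
    using \<open>0 < \<epsilon>\<close> \<open>h \<noteq> 0\<close> by (simp add: e_def)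
  then obtain d where "0 < d"
    and d: "\<And>y. norm (y - x0) < d \<Longrightarrow> norm (G y - H *v (y - x0)) \<le> e * norm (y - x0)"
    using G \<open>G x0 = 0\<close> unfolding has_derivative_at_alt by force
  have "G (x0 + z *\<^sub>R h) \<bullet> h \<le> z * (h \<bullet> (H *v h) + \<epsilon>)" if "0 < z" "z * norm h < d" for z
  proof -
    have "G (x0 + z *\<^sub>R h) \<bullet> h - z * (h \<bullet> (H *v h)) = (G (x0 + z *\<^sub>R h) - H *v (z *\<^sub>R h)) \<bullet> h"
      by (simp add: inner_diff_left inner_diff_right matrix_vector_mult_scaleR inner_commute)
    also have "\<dots> \<le> norm (G (x0 + z *\<^sub>R h) - H *v (z *\<^sub>R h)) * norm h"
      by (rule order_trans[OF abs_ge_self Cauchy_Schwarz_ineq2])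
    also have "\<dots> \<le> e * (z * norm h) * norm h"
      using d[of "x0 + z *\<^sub>R h"] that by (intro mult_right_mono) auto
    finally show ?thesis
      using \<open>h \<noteq> 0\<close> by (simp add: e_def power2_eq_square algebra_simps)
  qed
  with \<open>0 < d\<close> show ?thesis
    using that by blast
qed

lemma quadratic_growth_imp_hessian_lower_bound:
  fixes \<phi> :: "real^'n \<Rightarrow> real"
  assumes grad: "eventually (\<lambda>y. GDERIV \<phi> y :> G y) (nhds x0)"
    and G: "(G has_derivative (*v) H) (at x0)" and "G x0 = 0"
    and growth: "eventually (\<lambda>y. \<phi> x0 + c * (norm (y - x0))\<^sup>2 \<le> \<phi> y) (nhds x0)"
    and "0 \<le> c"
  shows "c * (norm h)\<^sup>2 \<le> h \<bullet> (H *v h)"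
proof (cases "h = 0")
  case False
  have "c * (norm h)\<^sup>2 \<le> h \<bullet> (H *v h) + \<epsilon>" if "0 < \<epsilon>" for \<epsilon>
  proof -
    define X where "X = h \<bullet> (H *v h) + \<epsilon>"
    obtain d1 where "0 < d1" and d1: "\<And>z. 0 < z \<Longrightarrow> z * norm h < d1 \<Longrightarrow> G (x0 + z *\<^sub>R h) \<bullet> h \<le> z * X"
      using has_derivative_along_ray_bound[OF G \<open>G x0 = 0\<close> \<open>0 < \<epsilon>\<close> False] unfolding X_def by blast
    obtain d2 where "0 < d2"
      and d2: "\<And>y. dist y x0 < d2 \<Longrightarrow> GDERIV \<phi> y :> G y \<and> \<phi> x0 + c * (norm (y - x0))\<^sup>2 \<le> \<phi> y"
      using eventually_conj[OF grad growth] unfolding eventually_nhds_metric by (auto simp: dist_commute)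
    define t where "t = min d1 d2 / (2 * norm h)"
    have "0 < t" and small: "t * norm h < min d1 d2"
      using \<open>0 < d1\<close> \<open>0 < d2\<close> False by (simp_all add: t_def min_def)
    have near: "dist (x0 + s *\<^sub>R h) x0 < d2" if "0 \<le> s" "s \<le> t" for s
      using mult_right_mono[OF that(2), of "norm h"] small that(1) by (simp add: dist_norm)
    obtain z where z: "0 < z" "z < t" and mvt: "\<phi> (x0 + t *\<^sub>R h) - \<phi> x0 = t * (G (x0 + z *\<^sub>R h) \<bullet> h)"
      using gradient_mean_value_along_ray[OF \<open>0 < t\<close>, of \<phi> x0 h G] d2 near by blast
    have "t * (t * (c * (norm h)\<^sup>2)) = c * (norm (x0 + t *\<^sub>R h - x0))\<^sup>2"
      using \<open>0 < t\<close> by (simp add: power2_eq_square)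
    also have "\<dots> \<le> t * (G (x0 + z *\<^sub>R h) \<bullet> h)"
      using d2[OF near[of t]] \<open>0 < t\<close> mvt by simp
    also have "\<dots> \<le> t * (z * X)"
      using d1[OF z(1)] mult_right_mono[of z t "norm h"] z small \<open>0 < t\<close> by simp
    finally have "t * (c * (norm h)\<^sup>2) \<le> z * X"
      using \<open>0 < t\<close> by simp
    moreover have "0 \<le> t * (c * (norm h)\<^sup>2)"
      using \<open>0 < t\<close> \<open>0 \<le> c\<close> by simp
    ultimately have "0 \<le> z * X"
      by linarith
    then have "0 \<le> X"
      using z(1) by (simp add: zero_le_mult_iff)
    then have "t * (c * (norm h)\<^sup>2) \<le> t * X"
      using \<open>t * (c * (norm h)\<^sup>2) \<le> z * X\<close> z(2) by (meson less_imp_le mult_right_mono order_trans)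
    then show ?thesis
      using \<open>0 < t\<close> unfolding X_def by simp
  qed
  then show ?thesis
    by (rule field_le_epsilon)
qed simp

lemma newton_step_superlinear:
  fixes G :: "real^'n \<Rightarrow> real^'n" and B :: "nat \<Rightarrow> real^'n^'n"
  assumes G: "(G has_derivative (*v) H) (at xs)" and "G xs = 0"
    and B: "B \<longlonglongrightarrow> H" and "0 < c"
    and coercive: "eventually (\<lambda>k. \<forall>h. c * (norm h)\<^sup>2 \<le> h \<bullet> (B k *v h)) sequentially"
    and y: "y \<longlonglongrightarrow> xs"
  shows "(\<lambda>k. norm (y k - matrix_inv (B k) *v G (y k) - xs)) \<in> o(\<lambda>k. norm (y k - xs))"
proof (rule landau_o.smallI)
  fix \<epsilon> :: real assume "0 < \<epsilon>"
  define e where "e = \<epsilon> * c / 2"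
  have "0 < e"
    using \<open>0 < \<epsilon>\<close> \<open>0 < c\<close> by (simp add: e_def)
  obtain d where "0 < d" and d: "\<And>z. norm (z - xs) < d \<Longrightarrow> norm (G z - H *v (z - xs)) \<le> e * norm (z - xs)"
    using G \<open>0 < e\<close> \<open>G xs = 0\<close> unfolding has_derivative_at_alt by force
  have "eventually (\<lambda>k. dist (B k) H < e) sequentially" "eventually (\<lambda>k. dist (y k) xs < d) sequentially"
    using tendstoD[OF B \<open>0 < e\<close>] tendstoD[OF y \<open>0 < d\<close>] .
  with coercive show "eventually (\<lambda>k. norm (norm (y k - matrix_inv (B k) *v G (y k) - xs))
      \<le> \<epsilon> * norm (norm (y k - xs))) sequentially"
  proof eventually_elim
    case (elim k)
    define v where "v = y k - xs"
    define u where "u = matrix_inv (B k) *v G (y k)"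
    have Bu: "B k *v u = G (y k)"
      unfolding u_def using coercive_matrix_inv_right elim(1) \<open>0 < c\<close> by blast
    have "B k *v (v - u) = (B k - H) *v v + (H *v v - G (y k))"
      using Bu by (simp add: matrix_vector_mult_diff_distrib matrix_vector_mult_diff_rdistrib)
    then have "norm (B k *v (v - u)) \<le> norm (B k - H) * norm v + norm (G (y k) - H *v v)"
      using norm_triangle_ineq[of "(B k - H) *v v" "H *v v - G (y k)"]
        norm_matrix_vector_mult_le[of "B k - H" v] by (simp add: norm_minus_commute)
    also have "\<dots> \<le> e * norm v + e * norm v"
      using elim(2) d[of "y k"] elim(3) unfolding v_def
      by (intro add_mono mult_right_mono) (auto simp: dist_norm)
    finally have "c * norm (v - u) \<le> 2 * e * norm v"
      using coercive_matrix_le_norm[of c "B k" "v - u"] elim(1) by auto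
    then show ?case
      using \<open>0 < c\<close> by (simp add: e_def u_def v_def algebra_simps)
  qed
qed

section \<open>Clarke generalized Jacobians\<close>

lemma convex_hull_limits_tendsto:
  fixes J0 :: "'m::real_normed_vector" and x0 :: "'a::metric_space"
  assumes D: "\<And>e. 0 < e \<Longrightarrow> \<exists>d>0. \<forall>y M. dist y x0 < d \<longrightarrow> D y M \<longrightarrow> dist M J0 \<le> e"
    and y: "y \<longlonglongrightarrow> x0"
    and A: "\<And>k. A k \<in> convex hull {B. \<exists>z J. (\<forall>i. D (z i) (J i)) \<and> z \<longlonglongrightarrow> y k \<and> J \<longlonglongrightarrow> B}"
  shows "A \<longlonglongrightarrow> J0"
proof (rule tendstoI)
  fix e :: real assume "0 < e"
  then obtain d where "0 < d" and d: "\<And>y M. dist y x0 < d \<Longrightarrow> D y M \<Longrightarrow> dist M J0 \<le> e / 2"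
    using D[of "e / 2"] by auto
  have "eventually (\<lambda>k. dist (y k) x0 < d) sequentially"
    using tendstoD[OF y \<open>0 < d\<close>] .
  then show "eventually (\<lambda>k. dist (A k) J0 < e) sequentially"
  proof eventually_elim
    case (elim k)
    have "{B. \<exists>z J. (\<forall>i. D (z i) (J i)) \<and> z \<longlonglongrightarrow> y k \<and> J \<longlonglongrightarrow> B} \<subseteq> cball J0 (e / 2)"
    proof clarify
      fix B z J assume DJ: "\<forall>i. D (z i) (J i)" and z: "z \<longlonglongrightarrow> y k" and J: "J \<longlonglongrightarrow> B"
      have "eventually (\<lambda>i. z i \<in> ball x0 d) sequentially"
        using topological_tendstoD[OF z open_ball] elim by (simp add: dist_commute)
      then have "eventually (\<lambda>i. J i \<in> cball J0 (e / 2)) sequentially"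
        by eventually_elim (use d DJ in \<open>force simp: dist_commute\<close>)
      then show "B \<in> cball J0 (e / 2)"
        by (rule Lim_in_closed_set[OF closed_cball _ _ J]) simp
    qed
    then have "convex hull {B. \<exists>z J. (\<forall>i. D (z i) (J i)) \<and> z \<longlonglongrightarrow> y k \<and> J \<longlonglongrightarrow> B} \<subseteq> cball J0 (e / 2)"
      by (rule hull_minimal) (rule convex_cball)
    then have "A k \<in> cball J0 (e / 2)"
      using A[of k] by blast
    then show ?case
      using \<open>0 < e\<close> by (simp add: dist_commute)
  qed
qed

lemma clarke_jac_tendsto:
  fixes F :: "real^'n \<Rightarrow> real^'n"
  assumes F: "eventually (\<lambda>y. (F has_derivative (*v) (J y)) (at y)) (nhds x0)"
    and J: "isCont J x0" and y: "y \<longlonglongrightarrow> x0" and A: "\<And>k. A k \<in> clarke_jac F (y k)"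
  shows "A \<longlonglongrightarrow> J x0"
proof (rule convex_hull_limits_tendsto[OF _ y A[unfolded clarke_jac_def]])
  fix e :: real assume "0 < e"
  from continuous_jacobian_close[OF F J this] obtain d where "0 < d"
    and d: "\<And>y. dist y x0 < d \<Longrightarrow> (F has_derivative (*v) (J y)) (at y) \<and> dist (J y) (J x0) \<le> e"
    by blast
  have "M = J y" if "dist y x0 < d" "(F has_derivative (\<lambda>h. M *v h)) (at y)" for y M
    using has_derivative_unique[OF that(2)] d[OF that(1)] by (metis matrix_eq)
  with d \<open>0 < d\<close> show "\<exists>d>0. \<forall>y M. dist y x0 < d \<longrightarrow> (F has_derivative (\<lambda>h. M *v h)) (at y)
      \<longrightarrow> dist M (J x0) \<le> e"
    by blast
qed

lemma clarke_jac_sv_tendsto: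
  fixes S :: "real^'n \<Rightarrow> (real^'n) set"
  assumes S: "eventually (\<lambda>z. S z = {p z} \<and> (p has_derivative (*v) (J z)) (at z)) (nhds z0)"
    and J: "isCont J z0" and y: "y \<longlonglongrightarrow> z0" and A: "\<And>k. A k \<in> clarke_jac_sv S (y k)"
  shows "A \<longlonglongrightarrow> J z0"
proof (rule convex_hull_limits_tendsto[OF _ y A[unfolded clarke_jac_sv_def]])
  fix e :: real assume "0 < e"
  from continuous_jacobian_close[OF S J this] obtain d where "0 < d"
    and d: "\<And>z. dist z z0 < d \<Longrightarrow> S z = {p z} \<and> (p has_derivative (*v) (J z)) (at z) \<and> dist (J z) (J z0) \<le> e"
    by blast
  have "M = J y" if y: "dist y z0 < d" and U: "open U" "y \<in> U" "\<forall>z\<in>U. S z = {p' z}"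
    and p': "(p' has_derivative (\<lambda>h. M *v h)) (at y)" for y M U p'
  proof -
    have "(p has_derivative (\<lambda>h. M *v h)) (at y)"
    proof (rule has_derivative_transform_within_open[OF p', of "U \<inter> ball z0 d"])
      show "open (U \<inter> ball z0 d)" "y \<in> U \<inter> ball z0 d"
        using U y by (auto simp: dist_commute)
      show "p' z = p z" if "z \<in> U \<inter> ball z0 d" for z
        using that U d[of z] by (auto simp: dist_commute)
    qed
    then show ?thesis
      using has_derivative_unique d[OF y] by (metis matrix_eq)
  qed
  with d \<open>0 < d\<close> show "\<exists>d>0. \<forall>y M. dist y z0 < d \<longrightarrow> (\<exists>U p'. open U \<and> y \<in> U \<and> (\<forall>z\<in>U. S z = {p' z})
      \<and> (p' has_derivative (\<lambda>h. M *v h)) (at y)) \<longrightarrow> dist M (J z0) \<le> e"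
    by blast
qed

section \<open>The forward-backward envelope\<close>

definition fb_model :: "real \<Rightarrow> ('a::real_inner \<Rightarrow> real) \<Rightarrow> ('a \<Rightarrow> 'a) \<Rightarrow> 'a \<Rightarrow> 'a \<Rightarrow> real" where
  "fb_model \<gamma> f Df x w = f x + Df x \<bullet> (w - x) + (norm (w - x))\<^sup>2 / (2 * \<gamma>)"

lemma fb_model_eq_prox_objective:
  assumes "0 < \<gamma>"
  shows "fb_model \<gamma> f Df x w
    = f x - \<gamma> / 2 * (norm (Df x))\<^sup>2 + (norm (w - (x - \<gamma> *\<^sub>R Df x)))\<^sup>2 / (2 * \<gamma>)"
proof -
  have "(norm (w - (x - \<gamma> *\<^sub>R Df x)))\<^sup>2
      = (norm (w - x))\<^sup>2 + 2 * \<gamma> * (Df x \<bullet> (w - x)) + \<gamma>\<^sup>2 * (norm (Df x))\<^sup>2"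
    unfolding power2_norm_eq_inner
    by (simp add: algebra_simps inner_diff_left inner_diff_right inner_commute power2_eq_square)
  then show ?thesis
    using assms unfolding fb_model_def by (simp add: field_simps power2_eq_square)
qed

lemma fb_op_minimizes_model:
  assumes "0 < \<gamma>" and "u \<in> fb_op \<gamma> Df g x"
  shows "ereal (fb_model \<gamma> f Df x u) + g u \<le> ereal (fb_model \<gamma> f Df x w) + g w"
proof -
  define c where "c = f x - \<gamma> / 2 * (norm (Df x))\<^sup>2"
  have "g u + ereal ((norm (u - (x - \<gamma> *\<^sub>R Df x)))\<^sup>2 / (2 * \<gamma>))
      \<le> g w + ereal ((norm (w - (x - \<gamma> *\<^sub>R Df x)))\<^sup>2 / (2 * \<gamma>))"
    using assms(2) unfolding fb_op_def prox_def by auto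
  then have "ereal c + (g u + ereal ((norm (u - (x - \<gamma> *\<^sub>R Df x)))\<^sup>2 / (2 * \<gamma>)))
      \<le> ereal c + (g w + ereal ((norm (w - (x - \<gamma> *\<^sub>R Df x)))\<^sup>2 / (2 * \<gamma>)))"
    by (rule add_left_mono)
  then show ?thesis
    unfolding fb_model_eq_prox_objective[OF assms(1)] c_def[symmetric]
    by (simp add: ac_simps flip: plus_ereal.simps(1))
qed

lemma fbe_eq_INF_model:
  "fbe \<gamma> f Df g x = real_of_ereal (INF w. ereal (fb_model \<gamma> f Df x w) + g w)"
  by (simp add: fbe_def fb_model_def)

lemma
  fixes f :: "'a::real_inner \<Rightarrow> real"
  assumes g: "proper_fun g" and \<gamma>: "0 < \<gamma>" and u: "u \<in> fb_op \<gamma> Df g x"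
  shows fb_op_cost_finite: "g u = ereal (real_of_ereal (g u))"
    and fbe_eq_at_fb_op: "fbe \<gamma> f Df g x = fb_model \<gamma> f Df x u + real_of_ereal (g u)"
    and fbe_le_model: "ereal (fbe \<gamma> f Df g x) \<le> ereal (fb_model \<gamma> f Df x w) + g w"
proof -
  note min = fb_op_minimizes_model[OF \<gamma> u, of f]
  obtain w0 where "g w0 \<noteq> \<infinity>" using g unfolding proper_fun_def by auto
  then have "g u \<noteq> \<infinity>" using min[of w0] by auto
  moreover have "g u \<noteq> -\<infinity>" using g unfolding proper_fun_def by auto
  ultimately obtain c where c: "g u = ereal c" by (cases "g u") auto
  then show "g u = ereal (real_of_ereal (g u))" by simp
  have "(INF w. ereal (fb_model \<gamma> f Df x w) + g w) = ereal (fb_model \<gamma> f Df x u) + g u"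
    by (rule antisym) (auto intro: INF_lower INF_greatest min)
  then show fbe: "fbe \<gamma> f Df g x = fb_model \<gamma> f Df x u + real_of_ereal (g u)"
    unfolding fbe_eq_INF_model c by simp
  show "ereal (fbe \<gamma> f Df g x) \<le> ereal (fb_model \<gamma> f Df x w) + g w"
    using min[of w] unfolding fbe c by simp
qed

lemma fb_sufficient_decrease:
  fixes f :: "'a::real_inner \<Rightarrow> real"
  assumes grad: "\<And>y. GDERIV f y :> Df y" and lip: "L-lipschitz_on UNIV Df"
    and g: "proper_fun g" and \<gamma>: "0 < \<gamma>" and u: "u \<in> fb_op \<gamma> Df g x"
    and \<sigma>: "\<sigma> \<le> \<gamma> * (1 - \<gamma> * L) / 2"
  shows "ereal (f u) + g u \<le> ereal (fbe \<gamma> f Df g x - \<sigma> * (norm ((1 / \<gamma>) *\<^sub>R (x - u)))\<^sup>2)"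
proof -
  have residual: "(norm ((1 / \<gamma>) *\<^sub>R (x - u)))\<^sup>2 = (norm (u - x))\<^sup>2 / \<gamma>\<^sup>2"
    using \<gamma> by (simp add: norm_minus_commute power_divide)
  have "\<sigma> * (norm ((1 / \<gamma>) *\<^sub>R (x - u)))\<^sup>2 \<le> \<gamma> * (1 - \<gamma> * L) / 2 * ((norm (u - x))\<^sup>2 / \<gamma>\<^sup>2)"
    unfolding residual by (rule mult_right_mono[OF \<sigma>]) simp
  also have "\<dots> = (norm (u - x))\<^sup>2 / (2 * \<gamma>) - L / 2 * (norm (u - x))\<^sup>2"
    using \<gamma> by (simp add: field_simps power2_eq_square)
  finally have "f u + real_of_ereal (g u) \<le> fbe \<gamma> f Df g x - \<sigma> * (norm ((1 / \<gamma>) *\<^sub>R (x - u)))\<^sup>2"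
    using lipschitz_gradient_upper_bound[OF grad lip, of u x]
    unfolding fbe_eq_at_fb_op[OF g \<gamma> u] fb_model_def by linarith
  then show ?thesis
    by (subst fb_op_cost_finite[OF g \<gamma> u]) simp
qed

lemma fbe_le_cost_plus_quadratic:
  fixes f :: "'a::real_inner \<Rightarrow> real"
  assumes grad: "\<And>y. GDERIV f y :> Df y" and lip: "L-lipschitz_on UNIV Df"
    and g: "proper_fun g" and \<gamma>: "0 < \<gamma>" and u: "u \<in> fb_op \<gamma> Df g x"
  shows "ereal (fbe \<gamma> f Df g x) \<le> ereal (f w + (L / 2 + 1 / (2 * \<gamma>)) * (norm (w - x))\<^sup>2) + g w"
proof -
  have "fb_model \<gamma> f Df x w \<le> f w + (L / 2 + 1 / (2 * \<gamma>)) * (norm (w - x))\<^sup>2"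
    using lipschitz_gradient_lower_bound[OF grad lip, of x w]
    unfolding fb_model_def by (simp add: algebra_simps add_divide_distrib)
  then have "ereal (fb_model \<gamma> f Df x w) + g w
      \<le> ereal (f w + (L / 2 + 1 / (2 * \<gamma>)) * (norm (w - x))\<^sup>2) + g w"
    by (intro add_right_mono) simp
  with fbe_le_model[OF g \<gamma> u] show ?thesis
    by (rule order_trans)
qed

lemma fbe_eq_cost_at_fixed_point:
  assumes g: "proper_fun g" and \<gamma>: "0 < \<gamma>" and x: "x \<in> fb_op \<gamma> Df g x"
  shows "ereal (fbe \<gamma> f Df g x) = ereal (f x) + g x"
  unfolding fbe_eq_at_fb_op[OF g \<gamma> x] fb_model_def by (subst fb_op_cost_finite[OF g \<gamma> x]) simp

lemma fb_model_mixed_difference: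
  "(fb_model \<gamma> f Df z' v' - fb_model \<gamma> f Df z v') - (fb_model \<gamma> f Df z' v - fb_model \<gamma> f Df z v)
    = (Df z' - Df z) \<bullet> (v' - v) - ((v' - v) \<bullet> (z' - z)) / \<gamma>"
proof -
  have "(norm (v' - z'))\<^sup>2 - (norm (v' - z))\<^sup>2 - (norm (v - z'))\<^sup>2 + (norm (v - z))\<^sup>2
      = - 2 * ((v' - v) \<bullet> (z' - z))"
    unfolding power2_norm_eq_inner
    by (simp add: inner_diff_left inner_diff_right inner_commute algebra_simps)
  moreover have "(fb_model \<gamma> f Df z' v' - fb_model \<gamma> f Df z v') - (fb_model \<gamma> f Df z' v - fb_model \<gamma> f Df z v)
      = (Df z' - Df z) \<bullet> (v' - v)
        + ((norm (v' - z'))\<^sup>2 - (norm (v' - z))\<^sup>2 - (norm (v - z'))\<^sup>2 + (norm (v - z))\<^sup>2) / (2 * \<gamma>)"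
    unfolding fb_model_def
    by (simp add: inner_diff_left inner_diff_right diff_divide_distrib add_divide_distrib algebra_simps)
  ultimately show ?thesis
    by simp
qed

lemma fb_model_mixed_difference_bound:
  assumes lip: "L-lipschitz_on UNIV Df" and "0 < \<gamma>"
  shows "\<bar>(fb_model \<gamma> f Df z' v' - fb_model \<gamma> f Df z v') - (fb_model \<gamma> f Df z' v - fb_model \<gamma> f Df z v)\<bar>
    \<le> (L + 1 / \<gamma>) * norm (z' - z) * norm (v' - v)"
proof -
  have "\<bar>(Df z' - Df z) \<bullet> (v' - v)\<bar> \<le> L * norm (z' - z) * norm (v' - v)"
    using Cauchy_Schwarz_ineq2[of "Df z' - Df z" "v' - v"] lipschitz_onD[OF lip, of z' z]
    by (simp add: dist_norm) (meson mult_right_mono norm_ge_zero order_trans)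
  moreover have "\<bar>((v' - v) \<bullet> (z' - z)) / \<gamma>\<bar> \<le> norm (z' - z) * norm (v' - v) / \<gamma>"
    using Cauchy_Schwarz_ineq2[of "v' - v" "z' - z"] \<open>0 < \<gamma>\<close> by (simp add: divide_right_mono mult.commute)
  moreover have "(L + 1 / \<gamma>) * norm (z' - z) * norm (v' - v)
      = L * norm (z' - z) * norm (v' - v) + norm (z' - z) * norm (v' - v) / \<gamma>"
    by (simp add: algebra_simps)
  ultimately show ?thesis
    unfolding fb_model_mixed_difference using abs_triangle_ineq4[of "(Df z' - Df z) \<bullet> (v' - v)"] by linarith
qed

lemma fb_model_has_derivative:
  fixes f :: "'a::real_inner \<Rightarrow> real"
  assumes "GDERIV f y :> Df y" "(Df has_derivative M) (at y)" "0 < \<gamma>"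
  shows "((\<lambda>z. fb_model \<gamma> f Df z u) has_derivative
      (\<lambda>h. ((1 / \<gamma>) *\<^sub>R (y - u)) \<bullet> h - \<gamma> * (M h \<bullet> ((1 / \<gamma>) *\<^sub>R (y - u))))) (at y)"
proof -
  have f': "(f has_derivative (\<lambda>h. h \<bullet> Df y)) (at y)"
    using assms(1) by (simp add: gderiv_def)
  have \<gamma>0: "\<gamma> \<noteq> 0"
    using assms(3) by simp
  have "((\<lambda>z. fb_model \<gamma> f Df z u) has_derivative
      (\<lambda>h. M h \<bullet> (u - y) - 2 * ((u - y) \<bullet> h) / (2 * \<gamma>))) (at y)"
    unfolding fb_model_def power2_norm_eq_inner
    apply (rule has_derivative_eq_rhs)
     apply (rule derivative_intros f' assms(2) | simp add: \<gamma>0)+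
    apply (simp add: fun_eq_iff inner_commute[of _ "Df y"] inner_commute[of _ "u - y"])
    done
  moreover have "M h \<bullet> (u - y) - 2 * ((u - y) \<bullet> h) / (2 * \<gamma>)
      = ((1 / \<gamma>) *\<^sub>R (y - u)) \<bullet> h - \<gamma> * (M h \<bullet> ((1 / \<gamma>) *\<^sub>R (y - u)))" for h
  proof -
    have "(u - y) \<bullet> h = - ((y - u) \<bullet> h)" "M h \<bullet> (u - y) = - (M h \<bullet> (y - u))"
      by (simp_all add: inner_diff_left inner_diff_right)
    then show ?thesis
      using assms(3) by simp
  qed
  ultimately show ?thesis
    by simp
qed

text \<open>
  \<open>\<phi>\<^sub>\<gamma>(z) - \<phi>\<^sub>\<gamma>(y)\<close> is squeezed between the model differences at \<open>T z\<close> and at \<open>T y\<close>; their gap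
  is \<open>o(\<parallel>z - y\<parallel>)\<close> because \<open>T\<close> is continuous at \<open>y\<close>.
\<close>

lemma fbe_has_derivative:
  fixes f :: "'a::real_inner \<Rightarrow> real"
  assumes grad: "\<And>y. GDERIV f y :> Df y" and lip: "L-lipschitz_on UNIV Df"
    and g: "proper_fun g" and \<gamma>: "0 < \<gamma>"
    and T: "\<And>z. z \<in> N \<Longrightarrow> fb_op \<gamma> Df g z = {T z}" and N: "open N" "y \<in> N"
    and T_cont: "isCont T y" and M: "(Df has_derivative M) (at y)"
  shows "(fbe \<gamma> f Df g has_derivative
           (\<lambda>h. ((1 / \<gamma>) *\<^sub>R (y - T y)) \<bullet> h - \<gamma> * (M h \<bullet> ((1 / \<gamma>) *\<^sub>R (y - T y))))) (at y)"
proof (rule has_derivative_squeeze)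
  define E where "E z = (fb_model \<gamma> f Df z (T z) - fb_model \<gamma> f Df y (T z))
    - (fb_model \<gamma> f Df z (T y) - fb_model \<gamma> f Df y (T y))" for z
  have T_in: "T z \<in> fb_op \<gamma> Df g z" if "z \<in> N" for z
    using T[OF that] by simp
  have fbe_at: "fbe \<gamma> f Df g z = fb_model \<gamma> f Df z (T z) + real_of_ereal (g (T z))" if "z \<in> N" for z
    using fbe_eq_at_fb_op[OF g \<gamma> T_in[OF that]] .
  have fbe_le: "fbe \<gamma> f Df g z \<le> fb_model \<gamma> f Df z (T z') + real_of_ereal (g (T z'))"
    if "z \<in> N" "z' \<in> N" for z z'
    using fbe_le_model[OF g \<gamma> T_in[OF that(1)], of f "T z'"]
    by (subst (asm) fb_op_cost_finite[OF g \<gamma> T_in[OF that(2)]]) simp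
  have "eventually (\<lambda>z. z \<in> N) (at y)"
    using N eventually_at_topological by blast
  then show "eventually (\<lambda>z. fb_model \<gamma> f Df z (T y) - fb_model \<gamma> f Df y (T y) + E z
      \<le> fbe \<gamma> f Df g z - fbe \<gamma> f Df g y
      \<and> fbe \<gamma> f Df g z - fbe \<gamma> f Df g y \<le> fb_model \<gamma> f Df z (T y) - fb_model \<gamma> f Df y (T y)) (at y)"
    by eventually_elim (use fbe_le fbe_at N(2) in \<open>force simp: E_def\<close>)
  have "\<bar>E z\<bar> \<le> (L + 1 / \<gamma>) * norm (z - y) * norm (T z - T y)" for z
    unfolding E_def by (rule fb_model_mixed_difference_bound[OF lip \<gamma>])
  then have "\<forall>z. norm (E z / norm (z - y)) \<le> (L + 1 / \<gamma>) * norm (T z - T y)"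
    by (auto simp: abs_divide divide_le_eq mult_ac)
  moreover have "((\<lambda>z. (L + 1 / \<gamma>) * norm (T z - T y)) \<longlongrightarrow> 0) (at y)"
    using T_cont by (intro tendsto_mult_right_zero tendsto_norm_zero) (simp add: isCont_def LIM_zero)
  ultimately show "((\<lambda>z. E z / norm (z - y)) \<longlongrightarrow> 0) (at y)"
    by (rule Lim_null_comparison[OF always_eventually])
  show "((\<lambda>z. fb_model \<gamma> f Df z (T y)) has_derivative
      (\<lambda>h. ((1 / \<gamma>) *\<^sub>R (y - T y)) \<bullet> h - \<gamma> * (M h \<bullet> ((1 / \<gamma>) *\<^sub>R (y - T y))))) (at y)"
    by (rule fb_model_has_derivative[OF grad M \<gamma>])
qed

section \<open>Sequences and the backtracking line search\<close>

lemma sufficient_decrease_tendsto_zero: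
  fixes F a :: "nat \<Rightarrow> real"
  assumes dec: "\<And>k. F (Suc k) \<le> F k - \<sigma> * a k" and bounded: "\<And>k. m \<le> F k"
    and "0 < \<sigma>" and "\<And>k. 0 \<le> a k"
  shows "a \<longlonglongrightarrow> 0"
proof -
  have "F (Suc k) \<le> F k" for k
    using dec[of k] mult_nonneg_nonneg[of \<sigma> "a k"] \<open>0 < \<sigma>\<close> \<open>0 \<le> a k\<close> by linarith
  then have "decseq F"
    by (rule decseq_SucI)
  then obtain l where l: "F \<longlonglongrightarrow> l"
    using decseq_convergent[of F m] bounded by blast
  have "(\<lambda>k. F k - F (Suc k)) \<longlonglongrightarrow> l - l"
    by (rule tendsto_diff[OF l LIMSEQ_Suc[OF l]])
  then have "(\<lambda>k. (F k - F (Suc k)) / \<sigma>) \<longlonglongrightarrow> 0"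
    using tendsto_divide[OF _ tendsto_const, of _ 0 _ \<sigma>] \<open>0 < \<sigma>\<close> by simp
  moreover have "a k \<le> (F k - F (Suc k)) / \<sigma>" for k
    using dec[of k] \<open>0 < \<sigma>\<close> by (simp add: field_simps)
  ultimately show ?thesis
    using \<open>\<And>k. 0 \<le> a k\<close> by (intro tendsto_sandwich[of "\<lambda>_. 0" a sequentially]) auto
qed

lemma merit_descent_residual_tendsto_zero:
  fixes F :: "nat \<Rightarrow> real" and r :: "nat \<Rightarrow> 'a::real_normed_vector"
  assumes descent: "\<And>k. F (Suc k) \<le> F k - \<sigma> * (norm (r k))\<^sup>2" and "0 < \<sigma>"
    and cost_le: "\<And>k. ereal (f (xb k)) + g (xb k) \<le> ereal (F k)"
    and argmin: "\<exists>z. \<forall>y. ereal (f z) + g z \<le> ereal (f y) + g y" and g: "proper_fun g"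
  shows "r \<longlonglongrightarrow> 0"
proof -
  obtain z where z: "\<And>y. ereal (f z) + g z \<le> ereal (f y) + g y"
    using argmin by blast
  have below: "ereal (f z) + g z \<le> ereal (F k)" for k
    using z[of "xb k"] cost_le[of k] by (rule order_trans)
  moreover have "g z \<noteq> -\<infinity>"
    using g unfolding proper_fun_def by blast
  ultimately obtain c where "g z = ereal c"
    using below[of 0] by (cases "g z") auto
  with below have "f z + c \<le> F k" for k
    by (metis plus_ereal.simps(1) ereal_less_eq(3))
  then have "(\<lambda>k. (norm (r k))\<^sup>2) \<longlonglongrightarrow> 0"
    by (rule sufficient_decrease_tendsto_zero[where a = "\<lambda>k. (norm (r k))\<^sup>2", OF descent _ \<open>0 < \<sigma>\<close>]) simp
  then have "(\<lambda>k. norm (r k)) \<longlonglongrightarrow> 0"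
    using tendsto_real_sqrt by fastforce
  then show ?thesis
    by (simp add: tendsto_norm_zero_iff)
qed

lemma
  fixes \<Phi> :: "real \<Rightarrow> real" and \<beta> \<mu> C q :: real
  assumes "\<exists>m::nat. \<tau> = \<beta> ^ m \<and> \<Phi> (\<beta> ^ m) \<le> C + \<mu> / 2 * (\<beta> ^ m)\<^sup>2 * q
      \<and> (\<forall>m'<m. \<not> \<Phi> (\<beta> ^ m') \<le> C + \<mu> / 2 * (\<beta> ^ m')\<^sup>2 * q)"
  shows backtracking_decrease: "q \<le> 0 \<Longrightarrow> 0 \<le> \<mu> \<Longrightarrow> \<Phi> \<tau> \<le> C"
    and backtracking_unit_step: "\<Phi> 1 \<le> C + \<mu> / 2 * q \<Longrightarrow> \<tau> = 1"
proof -
  obtain m :: nat where m: "\<tau> = \<beta> ^ m" "\<Phi> (\<beta> ^ m) \<le> C + \<mu> / 2 * (\<beta> ^ m)\<^sup>2 * q"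
    and first: "\<And>m'. m' < m \<Longrightarrow> \<not> \<Phi> (\<beta> ^ m') \<le> C + \<mu> / 2 * (\<beta> ^ m')\<^sup>2 * q"
    using assms by blast
  show "\<Phi> \<tau> \<le> C" if "q \<le> 0" "0 \<le> \<mu>"
  proof -
    have "\<mu> / 2 * (\<beta> ^ m)\<^sup>2 * q \<le> 0"
      using that by (intro mult_nonneg_nonpos) simp_all
    then show ?thesis
      using m by simp
  qed
  show "\<tau> = 1" if "\<Phi> 1 \<le> C + \<mu> / 2 * q"
  proof -
    have "m = 0"
      using first[of 0] that by (cases m) simp_all
    then show ?thesis
      using m(1) by simp
  qed
qed

lemma superlinear_conv_iff_smallo:
  "superlinear_conv u a \<longleftrightarrow> u \<longlonglongrightarrow> a \<and> (\<lambda>k. norm (u (Suc k) - a)) \<in> o(\<lambda>k. norm (u k - a))"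
  by (simp add: superlinear_conv_def smallo_def)

lemma superlinear_conv_iterates_and_residuals:
  fixes x xb r :: "nat \<Rightarrow> 'a::real_normed_vector"
  assumes x: "x \<longlonglongrightarrow> xs" and xb: "xb \<longlonglongrightarrow> xs"
    and r: "\<And>k. r k = (1 / \<gamma>) *\<^sub>R (x k - xb k)" and "0 < \<gamma>"
    and step: "(\<lambda>k. norm (x (Suc k) - xs)) \<in> o(\<lambda>k. norm (xb k - xs))"
    and xb_x: "(\<lambda>k. norm (xb k - xs)) \<in> O(\<lambda>k. norm (x k - xs))"
    and x_r: "(\<lambda>k. norm (x k - xs)) \<in> O(\<lambda>k. norm (r k))"
  shows "superlinear_conv x xs \<and> superlinear_conv xb xs \<and> superlinear_conv r 0"
proof -
  have r_x: "(\<lambda>k. norm (r k)) \<in> O(\<lambda>k. norm (x k - xs))"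
  proof -
    have "norm (r k) \<le> 1 / \<gamma> * norm (norm (x k - xs) + norm (xb k - xs))" for k
      using norm_triangle_ineq4[of "x k - xs" "xb k - xs"] \<open>0 < \<gamma>\<close> unfolding r
      by (simp add: divide_right_mono)
    then have "(\<lambda>k. norm (r k)) \<in> O(\<lambda>k. norm (x k - xs) + norm (xb k - xs))"
      using \<open>0 < \<gamma>\<close> by (intro landau_o.bigI[of "1 / \<gamma>"] always_eventually) auto
    also have "(\<lambda>k. norm (x k - xs) + norm (xb k - xs)) \<in> O(\<lambda>k. norm (x k - xs))"
      using xb_x by (intro sum_in_bigo) simp_all
    finally show ?thesis .
  qed
  have x_rate: "(\<lambda>k. norm (x (Suc k) - xs)) \<in> o(\<lambda>k. norm (x k - xs))"
    using step xb_x by (rule landau_o.small_big_trans)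
  have xb_rate: "(\<lambda>k. norm (xb (Suc k) - xs)) \<in> o(\<lambda>k. norm (xb k - xs))"
    using landau_o.big.compose[OF xb_x filterlim_Suc] step by (rule landau_o.big_small_trans)
  have "(\<lambda>k. norm (r (Suc k))) \<in> o(\<lambda>k. norm (r k))"
    using landau_o.big.compose[OF r_x filterlim_Suc] landau_o.small_big_trans[OF x_rate x_r]
    by (rule landau_o.big_small_trans)
  moreover have "r \<longlonglongrightarrow> 0"
    using tendsto_scaleR[OF tendsto_const tendsto_diff[OF x xb], of "1 / \<gamma>"] by (simp add: r[abs_def])
  ultimately show ?thesis
    using x xb x_rate xb_rate by (simp add: superlinear_conv_iff_smallo)
qed

section \<open>Local analysis at a regular strong minimizer\<close>

text \<open>
  The local analysis needs the Jacobians \<open>J\<close> of \<open>\<nabla>f\<close> and \<open>Jp\<close> of \<open>prox\<^sub>\<gamma>\<^sub>g\<close> to be continuous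
  only at the point itself. The fixed-point property \<open>T\<^sub>\<gamma>(x\<^sup>\<star>) = x\<^sup>\<star>\<close> is not automatic for
  nonconvex \<open>g\<close>; it is derived from the convergence of the iterates.
\<close>

locale fb_regular_point =
  fixes f :: "real^'n \<Rightarrow> real" and Df :: "real^'n \<Rightarrow> real^'n" and L :: real
    and g :: "real^'n \<Rightarrow> ereal" and \<gamma> :: real and xs :: "real^'n"
    and J :: "real^'n \<Rightarrow> real^'n^'n" and p :: "real^'n \<Rightarrow> real^'n" and Jp :: "real^'n \<Rightarrow> real^'n^'n"
  assumes f_grad: "\<And>y. GDERIV f y :> Df y"
    and Df_lip: "L-lipschitz_on UNIV Df"
    and g_proper: "proper_fun g"
    and \<gamma>_pos: "0 < \<gamma>" and \<gamma>_L: "\<gamma> * L < 1"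
    and hessian: "eventually (\<lambda>y. (Df has_derivative (*v) (J y)) (at y)) (nhds xs)"
    and hessian_cont: "isCont J xs"
    and prox_smooth: "eventually (\<lambda>z. prox \<gamma> g z = {p z} \<and> (p has_derivative (*v) (Jp z)) (at z))
      (nhds (xs - \<gamma> *\<^sub>R Df xs))"
    and prox_jacobian_cont: "isCont Jp (xs - \<gamma> *\<^sub>R Df xs)"
    and fixed_point: "p (xs - \<gamma> *\<^sub>R Df xs) = xs"
    and strong_min: "strong_local_min (\<lambda>y. ereal (f y) + g y) xs"
begin

definition T :: "real^'n \<Rightarrow> real^'n" where
  "T y = p (y - \<gamma> *\<^sub>R Df y)"

definition R :: "real^'n \<Rightarrow> real^'n" where
  "R y = (1 / \<gamma>) *\<^sub>R (y - T y)"

definition Q :: "real^'n \<Rightarrow> real^'n^'n" where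
  "Q y = mat 1 - \<gamma> *\<^sub>R J y"

definition P0 :: "real^'n^'n" where
  "P0 = Jp (xs - \<gamma> *\<^sub>R Df xs)"

definition DR :: "real^'n^'n" where
  "DR = (1 / \<gamma>) *\<^sub>R (mat 1 - P0 ** Q xs)"

definition H :: "real^'n^'n" where
  "H = (1 / \<gamma>) *\<^sub>R (Q xs ** (mat 1 - P0 ** Q xs))"

definition fbe_grad :: "real^'n \<Rightarrow> real^'n" where
  "fbe_grad y = transpose (Q y) *v R y"

lemma forward_step_isCont: "isCont (\<lambda>y. y - \<gamma> *\<^sub>R Df y) y"
  using lipschitz_on_continuous_on[OF Df_lip]
  by (intro continuous_intros) (simp add: continuous_on_eq_continuous_at)

lemma eventually_forward_step:
  assumes "eventually P (nhds (xs - \<gamma> *\<^sub>R Df xs))"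
  shows "eventually (\<lambda>y. P (y - \<gamma> *\<^sub>R Df y)) (nhds xs)"
  using eventually_compose_filterlim[OF assms] forward_step_isCont[of xs]
    tendsto_at_iff_tendsto_nhds[of "\<lambda>y. y - \<gamma> *\<^sub>R Df y" xs]
  by (simp add: isCont_def)

lemma eventually_fb_op_single:
  "eventually (\<lambda>y. fb_op \<gamma> Df g y = {T y} \<and> isCont T y \<and> (Df has_derivative (*v) (J y)) (at y)) (nhds xs)"
proof -
  have "eventually (\<lambda>z. eventually (\<lambda>z. prox \<gamma> g z = {p z} \<and> (p has_derivative (*v) (Jp z)) (at z)) (nhds z))
      (nhds (xs - \<gamma> *\<^sub>R Df xs))"
    using prox_smooth by (simp add: eventually_eventually)
  then have "eventually (\<lambda>y. eventually (\<lambda>z. prox \<gamma> g z = {p z} \<and> (p has_derivative (*v) (Jp z)) (at z))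
      (nhds (y - \<gamma> *\<^sub>R Df y))) (nhds xs)"
    by (rule eventually_forward_step)
  then show ?thesis
    using hessian
  proof eventually_elim
    case (elim y)
    then have "isCont p (y - \<gamma> *\<^sub>R Df y)"
      using has_derivative_continuous eventually_nhds_x_imp_x by blast
    then have "isCont T y"
      unfolding T_def using forward_step_isCont by (rule continuous_at_compose[unfolded o_def, rotated])
    with elim show ?case
      using eventually_nhds_x_imp_x[OF elim(1)] by (simp add: fb_op_def T_def)
  qed
qed

lemma T_fixed_point: "T xs = xs"
  using fixed_point by (simp add: T_def)

lemma R_xs: "R xs = 0"
  by (simp add: R_def T_fixed_point)

lemma T_has_derivative: "(T has_derivative (*v) (P0 ** Q xs)) (at xs)"
proof -
  have "((\<lambda>y. y - \<gamma> *\<^sub>R Df y) has_derivative (*v) (Q xs)) (at xs)"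
    using eventually_nhds_x_imp_x[OF hessian]
    by (auto intro!: derivative_eq_intros
        simp: Q_def fun_eq_iff matrix_vector_mult_diff_rdistrib scaleR_matrix_vector_assoc)
  moreover have "(p has_derivative (*v) P0) (at (xs - \<gamma> *\<^sub>R Df xs))"
    using eventually_nhds_x_imp_x[OF prox_smooth] by (simp add: P0_def)
  ultimately show ?thesis
    unfolding T_def by (rule has_derivative_compose[THEN has_derivative_eq_rhs])
      (simp add: fun_eq_iff matrix_vector_mul_assoc)
qed

lemma R_has_derivative: "(R has_derivative (*v) DR) (at xs)"
  unfolding R_def[abs_def] DR_def
  by (rule derivative_eq_intros T_has_derivative refl)+
    (simp add: fun_eq_iff matrix_vector_mult_diff_rdistrib flip: scaleR_matrix_vector_assoc)

lemma H_mult: "H *v h = Q xs *v (DR *v h)"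
  by (simp add: H_def DR_def matrix_vector_mul_assoc matrix_vector_mult_scaleR flip: scaleR_matrix_vector_assoc)

lemma fbe_grad_xs: "fbe_grad xs = 0"
  by (simp add: fbe_grad_def R_xs)

lemma eventually_fbe_gradient: "eventually (\<lambda>y. GDERIV (fbe \<gamma> f Df g) y :> fbe_grad y) (nhds xs)"
proof -
  obtain S where S: "open S" "xs \<in> S"
    and single: "\<And>y. y \<in> S \<Longrightarrow> fb_op \<gamma> Df g y = {T y} \<and> isCont T y \<and> (Df has_derivative (*v) (J y)) (at y)"
    using eventually_fb_op_single unfolding eventually_nhds by blast
  have "GDERIV (fbe \<gamma> f Df g) y :> fbe_grad y" if "y \<in> S" for y
  proof -
    have "(fbe \<gamma> f Df g has_derivative (\<lambda>h. R y \<bullet> h - \<gamma> * ((J y *v h) \<bullet> R y))) (at y)"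
      using fbe_has_derivative[OF f_grad Df_lip g_proper \<gamma>_pos _ S(1) that] single[OF that] single
      unfolding R_def by blast
    moreover have "R y \<bullet> h - \<gamma> * ((J y *v h) \<bullet> R y) = h \<bullet> fbe_grad y" for h
    proof -
      have "h \<bullet> fbe_grad y = (Q y *v h) \<bullet> R y"
        by (simp only: fbe_grad_def inner_transpose_matrix_vector)
      then show ?thesis
        by (simp add: Q_def matrix_vector_mult_diff_rdistrib inner_diff_left inner_diff_right inner_commute
            flip: scaleR_matrix_vector_assoc)
    qed
    ultimately show ?thesis
      by (simp add: gderiv_def)
  qed
  with S show ?thesis
    unfolding eventually_nhds by blast
qed

lemma isCont_transpose_Q: "isCont (\<lambda>y. transpose (Q y)) xs"
proof -
  have "linear (transpose :: real^'n^'n \<Rightarrow> real^'n^'n)"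
    by (auto intro!: linearI simp: transpose_def vec_eq_iff)
  then have "isCont transpose (Q xs)"
    by (simp add: linear_continuous_at linear_conv_bounded_linear)
  moreover have "isCont Q xs"
    unfolding Q_def[abs_def] using hessian_cont by (intro continuous_intros)
  ultimately show ?thesis
    by (rule continuous_at_compose[unfolded o_def, rotated])
qed

lemma transpose_Q_xs: "transpose (Q xs) = Q xs"
  using hessian_symmetric[OF f_grad hessian hessian_cont]
  by (simp add: Q_def transpose_def vec_eq_iff mat_def)

text \<open>
  By symmetry of the Hessian, the Jacobian \<open>Q\<^sup>T DR\<close> of the gradient equals \<open>H\<close>, the limit of
  the matrices \<open>B\<^sub>k\<close>, which are built from \<open>Q\<close> rather than \<open>Q\<^sup>T\<close>.
\<close>

lemma fbe_grad_has_derivative: "(fbe_grad has_derivative (*v) H) (at xs)"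
proof -
  have "(fbe_grad has_derivative (\<lambda>h. transpose (Q xs) *v (DR *v h))) (at xs)"
    unfolding fbe_grad_def[abs_def]
    by (rule has_derivative_matrix_mult_vanishing[OF R_has_derivative R_xs isCont_transpose_Q])
  then show ?thesis
    by (simp add: transpose_Q_xs H_mult[abs_def])
qed

lemma xs_fb_op: "xs \<in> fb_op \<gamma> Df g xs"
  using eventually_nhds_x_imp_x[OF eventually_fb_op_single] T_fixed_point by simp

lemma T_in_fb_op: "eventually (\<lambda>y. T y \<in> fb_op \<gamma> Df g y) (nhds xs)"
  using eventually_fb_op_single by eventually_elim simp

lemma fbe_xs: "ereal (fbe \<gamma> f Df g xs) = ereal (f xs) + g xs"
  by (rule fbe_eq_cost_at_fixed_point[OF g_proper \<gamma>_pos xs_fb_op])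

lemma cost_xs_finite: "g xs = ereal (real_of_ereal (g xs))"
  by (rule fb_op_cost_finite[OF g_proper \<gamma>_pos xs_fb_op])

lemma fbe_quadratic_upper_bound:
  "eventually (\<lambda>y. fbe \<gamma> f Df g y \<le> fbe \<gamma> f Df g xs + (L / 2 + 1 / (2 * \<gamma>)) * (norm (y - xs))\<^sup>2) (nhds xs)"
  using T_in_fb_op
proof eventually_elim
  case (elim y)
  have "ereal (fbe \<gamma> f Df g y) \<le> ereal (f xs + (L / 2 + 1 / (2 * \<gamma>)) * (norm (xs - y))\<^sup>2) + g xs"
    by (rule fbe_le_cost_plus_quadratic[OF f_grad Df_lip g_proper \<gamma>_pos elim])
  then show ?case
    using fbe_xs by (subst (asm) cost_xs_finite, subst (asm) (2) cost_xs_finite) (simp add: norm_minus_commute)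
qed

lemma fbe_quadratic_growth:
  obtains c where "0 < c" "eventually (\<lambda>y. fbe \<gamma> f Df g xs + c * (norm (y - xs))\<^sup>2 \<le> fbe \<gamma> f Df g y) (nhds xs)"
proof -
  obtain c0 \<epsilon> where "0 < c0" "0 < \<epsilon>"
    and growth: "\<And>y. norm (y - xs) < \<epsilon> \<Longrightarrow> ereal (f xs) + g xs + ereal (c0 * (norm (y - xs))\<^sup>2) \<le> ereal (f y) + g y"
    using strong_min unfolding strong_local_min_def by blast
  define \<sigma> where "\<sigma> = \<gamma> * (1 - \<gamma> * L) / 2"
  have "0 < \<sigma>"
    using \<gamma>_pos \<gamma>_L by (simp add: \<sigma>_def)
  define c where "c = min c0 (\<sigma> / \<gamma>\<^sup>2) / 2"
  have "0 < c"
    using \<open>0 < c0\<close> \<open>0 < \<sigma>\<close> \<gamma>_pos by (simp add: c_def)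
  have "(T \<longlongrightarrow> T xs) (nhds xs)"
    using has_derivative_continuous[OF T_has_derivative] by (simp add: isCont_def tendsto_at_iff_tendsto_nhds)
  from tendstoD[OF this \<open>0 < \<epsilon>\<close>] have "eventually (\<lambda>y. norm (T y - xs) < \<epsilon>) (nhds xs)"
    by (simp add: dist_norm T_fixed_point)
  with T_in_fb_op have "eventually (\<lambda>y. fbe \<gamma> f Df g xs + c * (norm (y - xs))\<^sup>2 \<le> fbe \<gamma> f Df g y) (nhds xs)"
  proof eventually_elim
    case (elim y)
    have split: "y - xs = (T y - xs) + \<gamma> *\<^sub>R R y"
      using \<gamma>_pos by (simp add: R_def)
    have "ereal (f (T y)) + g (T y) \<le> ereal (fbe \<gamma> f Df g y - \<sigma> * (norm (R y))\<^sup>2)"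
      unfolding R_def using fb_sufficient_decrease[OF f_grad Df_lip g_proper \<gamma>_pos elim(1)] \<sigma>_def by simp
    with growth[OF elim(2), folded fbe_xs]
    have "ereal (fbe \<gamma> f Df g xs + c0 * (norm (T y - xs))\<^sup>2) \<le> ereal (fbe \<gamma> f Df g y - \<sigma> * (norm (R y))\<^sup>2)"
      by (simp del: ereal_less_eq)
    moreover have "c * (norm (y - xs))\<^sup>2 \<le> c0 * (norm (T y - xs))\<^sup>2 + \<sigma> / \<gamma>\<^sup>2 * (norm (\<gamma> *\<^sub>R R y))\<^sup>2"
      unfolding c_def split by (rule norm_add_squared_weighted_le) (use \<open>0 < c0\<close> \<open>0 < \<sigma>\<close> in simp_all)
    moreover have "\<sigma> / \<gamma>\<^sup>2 * (norm (\<gamma> *\<^sub>R R y))\<^sup>2 = \<sigma> * (norm (R y))\<^sup>2"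
      using \<gamma>_pos by (simp add: power_mult_distrib)
    ultimately show ?case
      unfolding ereal_less_eq(3) by linarith
  qed
  with \<open>0 < c\<close> show ?thesis
    using that by blast
qed

lemma H_coercive:
  obtains c where "0 < c" "\<And>h. c * (norm h)\<^sup>2 \<le> h \<bullet> (H *v h)"
proof -
  obtain c where "0 < c" and growth: "eventually (\<lambda>y. fbe \<gamma> f Df g xs + c * (norm (y - xs))\<^sup>2 \<le> fbe \<gamma> f Df g y) (nhds xs)"
    using fbe_quadratic_growth by blast
  have "c * (norm h)\<^sup>2 \<le> h \<bullet> (H *v h)" for h
    using quadratic_growth_imp_hessian_lower_bound[OF eventually_fbe_gradient fbe_grad_has_derivative
        fbe_grad_xs growth] \<open>0 < c\<close> by simp
  with \<open>0 < c\<close> show ?thesis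
    using that by blast
qed

lemma residual_lower_bound:
  obtains K where "eventually (\<lambda>y. norm (y - xs) \<le> K * norm (R y)) (nhds xs)"
proof -
  obtain c where "0 < c" and c: "\<And>h. c * (norm h)\<^sup>2 \<le> h \<bullet> (H *v h)"
    using H_coercive by blast
  define c' where "c' = c / (norm (Q xs) + 1)"
  have pos: "0 < norm (Q xs) + 1"
    by (simp add: add_nonneg_pos)
  then have "0 < c'"
    using \<open>0 < c\<close> by (simp add: c'_def)
  have "c' * norm h \<le> norm (DR *v h)" for h
  proof -
    have "c * norm h \<le> norm (Q xs *v (DR *v h))"
      using coercive_matrix_le_norm[OF c] by (simp add: H_mult)
    also have "\<dots> \<le> (norm (Q xs) + 1) * norm (DR *v h)"
      using norm_matrix_vector_mult_le[of "Q xs" "DR *v h"] norm_ge_zero[of "DR *v h"]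
      unfolding distrib_right by linarith
    finally show ?thesis
      using pos by (simp add: c'_def divide_le_eq mult.commute)
  qed
  from has_derivative_injective_lower_bound[OF R_has_derivative \<open>0 < c'\<close> this]
  have "eventually (\<lambda>y. norm (y - xs) \<le> 2 / c' * norm (R y)) (nhds xs)"
    by eventually_elim (use \<open>0 < c'\<close> in \<open>simp add: R_xs field_simps\<close>)
  then show ?thesis
    by (rule that)
qed

lemma T_lipschitz_at:
  obtains \<Lambda> where "eventually (\<lambda>y. norm (T y - xs) \<le> \<Lambda> * norm (y - xs)) (nhds xs)"
  using has_derivative_imp_lipschitz_at[OF T_has_derivative] T_fixed_point by metis

lemma newton_matrices_tendsto:
  assumes y: "y \<longlonglongrightarrow> xs"
    and Q: "\<And>k. \<exists>A \<in> clarke_jac Df (y k). Q' k = mat 1 - \<gamma> *\<^sub>R A"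
    and P: "\<And>k. P k \<in> clarke_jac_sv (prox \<gamma> g) (y k - \<gamma> *\<^sub>R Df (y k))"
  shows "(\<lambda>k. (1 / \<gamma>) *\<^sub>R (Q' k ** (mat 1 - P k ** Q' k))) \<longlonglongrightarrow> H"
proof -
  obtain A where A: "\<And>k. A k \<in> clarke_jac Df (y k)" and QA: "\<And>k. Q' k = mat 1 - \<gamma> *\<^sub>R A k"
    using Q by metis
  have "A \<longlonglongrightarrow> J xs"
    by (rule clarke_jac_tendsto[OF hessian hessian_cont y A])
  then have "Q' \<longlonglongrightarrow> Q xs"
    unfolding QA[abs_def] Q_def by (intro tendsto_intros)
  moreover have "(\<lambda>k. y k - \<gamma> *\<^sub>R Df (y k)) \<longlonglongrightarrow> xs - \<gamma> *\<^sub>R Df xs"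
    using forward_step_isCont y by (rule isCont_tendsto_compose)
  then have "P \<longlonglongrightarrow> P0"
    unfolding P0_def by (rule clarke_jac_sv_tendsto[OF prox_smooth prox_jacobian_cont _ P])
  ultimately show ?thesis
    unfolding H_def by (intro tendsto_intros)
qed

lemma eventually_fbe_below_cost:
  obtains \<eta> where "0 < \<eta>"
    "eventually (\<lambda>y. \<forall>z. norm (z - xs) \<le> \<eta> * norm (y - xs) \<longrightarrow> ereal (fbe \<gamma> f Df g z) \<le> ereal (f y) + g y) (nhds xs)"
proof -
  obtain c \<epsilon> where "0 < c" "0 < \<epsilon>"
    and growth: "\<And>y. norm (y - xs) < \<epsilon> \<Longrightarrow> ereal (f xs) + g xs + ereal (c * (norm (y - xs))\<^sup>2) \<le> ereal (f y) + g y"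
    using strong_min unfolding strong_local_min_def by blast
  define M where "M = L / 2 + 1 / (2 * \<gamma>)"
  have "0 \<le> M"
    using lipschitz_on_nonneg[OF Df_lip] \<gamma>_pos by (simp add: M_def)
  obtain \<rho> where "0 < \<rho>" and upper: "\<And>z. dist z xs < \<rho> \<Longrightarrow> fbe \<gamma> f Df g z \<le> fbe \<gamma> f Df g xs + M * (norm (z - xs))\<^sup>2"
    using fbe_quadratic_upper_bound unfolding eventually_nhds_metric M_def by blast
  define \<eta> where "\<eta> = min 1 (c / (M + 1))"
  have "0 < \<eta>" "\<eta> \<le> 1"
    using \<open>0 < c\<close> \<open>0 \<le> M\<close> by (simp_all add: \<eta>_def)
  have "M * \<eta>\<^sup>2 \<le> c"
  proof -
    have "M * \<eta>\<^sup>2 \<le> M * \<eta>"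
      using \<open>0 < \<eta>\<close> \<open>\<eta> \<le> 1\<close> \<open>0 \<le> M\<close> by (intro mult_left_mono) (simp_all add: power2_eq_square)
    also have "\<dots> \<le> (M + 1) * (c / (M + 1))"
      using \<open>0 \<le> M\<close> \<open>0 < \<eta>\<close> by (intro mult_mono) (simp_all add: \<eta>_def)
    finally show ?thesis
      using \<open>0 \<le> M\<close> by simp
  qed
  have "ereal (fbe \<gamma> f Df g z) \<le> ereal (f y) + g y"
    if y: "norm (y - xs) < min \<epsilon> \<rho>" and z: "norm (z - xs) \<le> \<eta> * norm (y - xs)" for y z
  proof -
    have "norm (z - xs) \<le> norm (y - xs)"
      using z \<open>\<eta> \<le> 1\<close> by (meson mult_left_le_one_le norm_ge_zero order_trans \<open>0 < \<eta>\<close> less_imp_le)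
    then have "fbe \<gamma> f Df g z \<le> fbe \<gamma> f Df g xs + M * (norm (z - xs))\<^sup>2"
      using upper y by (simp add: dist_norm)
    also have "M * (norm (z - xs))\<^sup>2 \<le> M * (\<eta> * norm (y - xs))\<^sup>2"
      using z \<open>0 \<le> M\<close> by (intro mult_left_mono power_mono) simp_all
    also have "\<dots> \<le> c * (norm (y - xs))\<^sup>2"
      using \<open>M * \<eta>\<^sup>2 \<le> c\<close> by (simp add: power_mult_distrib mult.assoc[symmetric] mult_right_mono)
    finally have "ereal (fbe \<gamma> f Df g z) \<le> ereal (fbe \<gamma> f Df g xs) + ereal (c * (norm (y - xs))\<^sup>2)"
      by simp
    also have "\<dots> \<le> ereal (f y) + g y"
      using growth y by (simp add: fbe_xs)
    finally show ?thesis .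
  qed
  then have "eventually (\<lambda>y. \<forall>z. norm (z - xs) \<le> \<eta> * norm (y - xs) \<longrightarrow> ereal (fbe \<gamma> f Df g z) \<le> ereal (f y) + g y) (nhds xs)"
    using \<open>0 < \<epsilon>\<close> \<open>0 < \<rho>\<close> unfolding eventually_nhds_metric dist_norm by (metis min_less_iff_conj)
  with \<open>0 < \<eta>\<close> show ?thesis
    using that by blast
qed

lemma newton_direction_superlinear:
  assumes xb: "xb \<longlonglongrightarrow> xs"
    and Q_sel: "\<And>k. \<exists>A \<in> clarke_jac Df (xb k). Q' k = mat 1 - \<gamma> *\<^sub>R A"
    and P_sel: "\<And>k. P k \<in> clarke_jac_sv (prox \<gamma> g) (xb k - \<gamma> *\<^sub>R Df (xb k))"
    and B_def: "\<And>k. B k = (1 / \<gamma>) *\<^sub>R (Q' k ** (mat 1 - P k ** Q' k))"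
    and s_nonpos: "\<And>k. inner (B k *v s k) (s k) \<le> 0"
    and d_newton: "eventually (\<lambda>k. \<exists>v. GDERIV (fbe \<gamma> f Df g) (xb k) :> v
                       \<and> d k = - (matrix_inv (B k) *v v)) sequentially"
  shows "eventually (\<lambda>k. s k = 0) sequentially"
    and "(\<lambda>k. norm (xb k + d k - xs)) \<in> o(\<lambda>k. norm (xb k - xs))"
proof -
  have B: "B \<longlonglongrightarrow> H"
    unfolding B_def[abs_def] by (rule newton_matrices_tendsto[OF xb Q_sel P_sel])
  obtain c where "0 < c" and c: "\<And>h. c * (norm h)\<^sup>2 \<le> h \<bullet> (H *v h)"
    using H_coercive by blast
  have coercive: "eventually (\<lambda>k. \<forall>h. c / 2 * (norm h)\<^sup>2 \<le> h \<bullet> (B k *v h)) sequentially"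
    using tendstoD[OF B half_gt_zero[OF \<open>0 < c\<close>]]
  proof eventually_elim
    case (elim k)
    have "(c / 2) * (norm h)\<^sup>2 \<le> (c - norm (B k - H)) * (norm h)\<^sup>2" for h
      using elim by (intro mult_right_mono) (simp_all add: dist_norm)
    with coercive_matrix_perturb[OF c] show ?case
      by (meson order_trans)
  qed
  then show "eventually (\<lambda>k. s k = 0) sequentially"
  proof eventually_elim
    case (elim k)
    then have "c / 2 * (norm (s k))\<^sup>2 \<le> 0"
      using s_nonpos[of k] by (metis inner_commute order_trans)
    then show ?case
      using \<open>0 < c\<close> by (simp add: mult_le_0_iff)
  qed
  have "eventually (\<lambda>k. GDERIV (fbe \<gamma> f Df g) (xb k) :> fbe_grad (xb k)) sequentially"
    using eventually_compose_filterlim[OF eventually_fbe_gradient xb] .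
  with d_newton have "eventually (\<lambda>k. xb k + d k - xs = xb k - matrix_inv (B k) *v fbe_grad (xb k) - xs) sequentially"
    by eventually_elim (metis gderiv_unique diff_conv_add_uminus)
  moreover have "(\<lambda>k. norm (xb k - matrix_inv (B k) *v fbe_grad (xb k) - xs)) \<in> o(\<lambda>k. norm (xb k - xs))"
    using \<open>0 < c\<close> by (intro newton_step_superlinear[OF fbe_grad_has_derivative fbe_grad_xs B _ coercive xb]) simp
  ultimately show "(\<lambda>k. norm (xb k + d k - xs)) \<in> o(\<lambda>k. norm (xb k - xs))"
    by (subst landau_o.small.in_cong) (auto elim: eventually_mono)
qed

lemma residual_error_bounds:
  assumes x: "x \<longlonglongrightarrow> xs" and xb_sel: "\<And>k. xb k \<in> fb_op \<gamma> Df g (x k)"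
    and r_def: "\<And>k. r k = (1 / \<gamma>) *\<^sub>R (x k - xb k)"
  shows "(\<lambda>k. norm (xb k - xs)) \<in> O(\<lambda>k. norm (x k - xs))"
    and "(\<lambda>k. norm (x k - xs)) \<in> O(\<lambda>k. norm (r k))"
proof -
  have xb_T: "eventually (\<lambda>k. xb k = T (x k)) sequentially"
    using eventually_compose_filterlim[OF eventually_fb_op_single x] by eventually_elim (use xb_sel in auto)
  obtain \<Lambda> where "eventually (\<lambda>y. norm (T y - xs) \<le> \<Lambda> * norm (y - xs)) (nhds xs)"
    using T_lipschitz_at by blast
  from eventually_compose_filterlim[OF this x] xb_T
  have "eventually (\<lambda>k. norm (norm (xb k - xs)) \<le> (\<bar>\<Lambda>\<bar> + 1) * norm (norm (x k - xs))) sequentially"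
  proof eventually_elim
    case (elim k)
    have "\<Lambda> * norm (x k - xs) \<le> (\<bar>\<Lambda>\<bar> + 1) * norm (x k - xs)"
      by (intro mult_right_mono) simp_all
    with elim show ?case
      by simp
  qed
  then show "(\<lambda>k. norm (xb k - xs)) \<in> O(\<lambda>k. norm (x k - xs))"
    by (intro landau_o.bigI) simp_all
  obtain K where "eventually (\<lambda>y. norm (y - xs) \<le> K * norm (R y)) (nhds xs)"
    using residual_lower_bound by blast
  from eventually_compose_filterlim[OF this x] xb_T
  have "eventually (\<lambda>k. norm (norm (x k - xs)) \<le> (\<bar>K\<bar> + 1) * norm (norm (r k))) sequentially"
  proof eventually_elim
    case (elim k)
    have "K * norm (r k) \<le> (\<bar>K\<bar> + 1) * norm (r k)"
      by (intro mult_right_mono) simp_all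
    with elim show ?case
      by (simp add: R_def r_def)
  qed
  then show "(\<lambda>k. norm (x k - xs)) \<in> O(\<lambda>k. norm (r k))"
    by (intro landau_o.bigI) simp_all
qed

end

lemma fb_fixed_point_of_limit:
  assumes Df: "isCont Df xs" and U: "open U" "xs - \<gamma> *\<^sub>R Df xs \<in> U"
    and single: "\<And>z. z \<in> U \<Longrightarrow> prox \<gamma> g z = {p z}" and p: "isCont p (xs - \<gamma> *\<^sub>R Df xs)"
    and x: "x \<longlonglongrightarrow> xs" and xb: "xb \<longlonglongrightarrow> xs" and xb_sel: "\<And>k. xb k \<in> fb_op \<gamma> Df g (x k)"
  shows "p (xs - \<gamma> *\<^sub>R Df xs) = xs"
proof -
  have w: "(\<lambda>k. x k - \<gamma> *\<^sub>R Df (x k)) \<longlonglongrightarrow> xs - \<gamma> *\<^sub>R Df xs"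
    using x isCont_tendsto_compose[OF Df x] by (intro tendsto_intros)
  then have "eventually (\<lambda>k. x k - \<gamma> *\<^sub>R Df (x k) \<in> U) sequentially"
    using U by (rule topological_tendstoD)
  then have "eventually (\<lambda>k. xb k = p (x k - \<gamma> *\<^sub>R Df (x k))) sequentially"
    by eventually_elim (use xb_sel single in \<open>auto simp: fb_op_def\<close>)
  moreover have "(\<lambda>k. p (x k - \<gamma> *\<^sub>R Df (x k))) \<longlonglongrightarrow> p (xs - \<gamma> *\<^sub>R Df xs)"
    using p w by (rule isCont_tendsto_compose)
  ultimately have "xb \<longlonglongrightarrow> p (xs - \<gamma> *\<^sub>R Df xs)"
    by (simp add: tendsto_cong)
  then show ?thesis
    using xb LIMSEQ_unique by blast
qed

lemma fb_regular_point_of_limit: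
  fixes f :: "real^'n \<Rightarrow> real" and g :: "real^'n \<Rightarrow> ereal"
  assumes f_grad: "\<And>y. GDERIV f y :> Df y" and Df_lip: "L-lipschitz_on UNIV Df"
    and g_proper: "proper_fun g" and \<gamma>_pos: "0 < \<gamma>" and \<gamma>_L: "\<gamma> * L < 1"
    and f_C3: "\<exists>U. open U \<and> xs \<in> U \<and> C3_on U f"
    and prox_C1: "\<exists>U p. open U \<and> xs - \<gamma> *\<^sub>R Df xs \<in> U \<and> (\<forall>z\<in>U. prox \<gamma> g z = {p z}) \<and> C1_on U p"
    and strong_min: "strong_local_min (\<lambda>y. ereal (f y) + g y) xs"
    and x: "x \<longlonglongrightarrow> xs" and xb: "xb \<longlonglongrightarrow> xs" and xb_sel: "\<And>k. xb k \<in> fb_op \<gamma> Df g (x k)"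
  obtains J p Jp where "fb_regular_point f Df L g \<gamma> xs J p Jp"
proof -
  obtain V where V: "open V" "xs \<in> V" "C3_on V f"
    using f_C3 by blast
  obtain J where J: "\<And>y. y \<in> V \<Longrightarrow> (Df has_derivative (*v) (J y)) (at y)" "continuous_on V J"
    using C1_on_imp_continuous_jacobian[OF C3_on_imp_C1_on_gradient[OF f_grad V(1,3)]] by blast
  define zs where "zs = xs - \<gamma> *\<^sub>R Df xs"
  obtain U p where U: "open U" "zs \<in> U" "\<And>z. z \<in> U \<Longrightarrow> prox \<gamma> g z = {p z}" "C1_on U p"
    using prox_C1 unfolding zs_def by blast
  obtain Jp where Jp: "\<And>z. z \<in> U \<Longrightarrow> (p has_derivative (*v) (Jp z)) (at z)" "continuous_on U Jp"
    using C1_on_imp_continuous_jacobian[OF U(4)] by blast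
  have "fb_regular_point f Df L g \<gamma> xs J p Jp"
  proof
    show "eventually (\<lambda>y. (Df has_derivative (*v) (J y)) (at y)) (nhds xs)"
      using V J(1) unfolding eventually_nhds by blast
    show "isCont J xs"
      using J(2) V by (simp add: continuous_on_eq_continuous_at)
    show "eventually (\<lambda>z. prox \<gamma> g z = {p z} \<and> (p has_derivative (*v) (Jp z)) (at z)) (nhds (xs - \<gamma> *\<^sub>R Df xs))"
      using U Jp(1) unfolding eventually_nhds zs_def[symmetric] by blast
    show "isCont Jp (xs - \<gamma> *\<^sub>R Df xs)"
      using Jp(2) U unfolding zs_def by (simp add: continuous_on_eq_continuous_at)
    have "isCont Df xs"
      using lipschitz_on_continuous_on[OF Df_lip] by (simp add: continuous_on_eq_continuous_at)
    then show "p (xs - \<gamma> *\<^sub>R Df xs) = xs"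
      using fb_fixed_point_of_limit[OF _ U(1) U(2)[unfolded zs_def] U(3) _ x xb xb_sel]
        has_derivative_continuous[OF Jp(1)[OF U(2)]] unfolding zs_def by blast
  qed (fact assms)+
  then show ?thesis
    by (rule that)
qed

theorem theorem5p5:
  fixes f :: "real^'n \<Rightarrow> real" and Df :: "real^'n \<Rightarrow> real^'n" and L :: real
    and g :: "real^'n \<Rightarrow> ereal" and \<gamma>g :: ereal and \<rho> :: real
    and \<gamma> \<sigma> \<beta> \<mu> :: real
    and x xb r rb d s :: "nat \<Rightarrow> real^'n"
    and Q P B :: "nat \<Rightarrow> real^'n^'n" and \<tau> :: "nat \<Rightarrow> real"
    and xs :: "real^'n"
  assumes f_grad: "\<And>y. GDERIV f y :> Df y"
    and L_pos: "0 < L" and Df_lip: "L-lipschitz_on UNIV Df"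
    and g_proper: "proper_fun g" and g_lsc: "lsc_fun g"
    and \<gamma>g_pos: "0 < \<gamma>g" and g_pb: "prox_bounded \<gamma>g g"
    and g_wc: "weakly_convex \<rho> g"
    and argmin_ne: "\<exists>z. \<forall>y. ereal (f z) + g z \<le> ereal (f y) + g y"
    and \<gamma>_pos: "0 < \<gamma>" and \<gamma>_L: "\<gamma> < 1 / L" and \<gamma>_g: "ereal \<gamma> < \<gamma>g"
    and \<sigma>_pos: "0 < \<sigma>" and \<sigma>_bd: "\<sigma> < \<gamma> * (1 - \<gamma> * L) / 2"
    and \<beta>_bds: "0 < \<beta>" "\<beta> < 1" and \<mu>_bds: "0 < \<mu>" "\<mu> < 1"
    \<comment> \<open>the PGCL iteration (it never stops, since it generates an infinite sequence)\<close>
    and xb_sel: "\<And>k. xb k \<in> fb_op \<gamma> Df g (x k)"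
    and r_def: "\<And>k. r k = (1 / \<gamma>) *\<^sub>R (x k - xb k)"
    and rb_sel: "\<And>k. rb k \<in> fb_res \<gamma> Df g (xb k)"
    and Q_sel: "\<And>k. \<exists>A \<in> clarke_jac Df (xb k). Q k = mat 1 - \<gamma> *\<^sub>R A"
    and P_sel: "\<And>k. P k \<in> clarke_jac_sv (prox \<gamma> g) (xb k - \<gamma> *\<^sub>R Df (xb k))"
    and B_def: "\<And>k. B k = (1 / \<gamma>) *\<^sub>R (Q k ** (mat 1 - P k ** Q k))"
    and no_stop: "\<And>k. \<not> (rb k = 0 \<and> lambda_min (B k) \<ge> 0)"
    and d_dir: "\<And>k. inner (Q k *v rb k) (d k) \<le> 0"
    and s_dir: "\<And>k. inner (Q k *v rb k) (s k) \<le> 0"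
    and s_neg: "\<And>k. lambda_min (B k) < 0 \<Longrightarrow> inner (B k *v s k) (s k) < 0"
    and s_zero: "\<And>k. \<not> lambda_min (B k) < 0 \<Longrightarrow> inner (B k *v s k) (s k) = 0"
    and ls: "\<And>k. \<exists>m::nat. \<tau> k = \<beta> ^ m
       \<and> fbe \<gamma> f Df g (xb k + (\<beta> ^ m)\<^sup>2 *\<^sub>R d k + \<beta> ^ m *\<^sub>R s k)
           \<le> fbe \<gamma> f Df g (x k) - \<sigma> * (norm (r k))\<^sup>2
              + \<mu> / 2 * (\<beta> ^ m)\<^sup>2 * inner (B k *v s k) (s k)
       \<and> (\<forall>m'<m. \<not> (fbe \<gamma> f Df g (xb k + (\<beta> ^ m')\<^sup>2 *\<^sub>R d k + \<beta> ^ m' *\<^sub>R s k)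
           \<le> fbe \<gamma> f Df g (x k) - \<sigma> * (norm (r k))\<^sup>2
              + \<mu> / 2 * (\<beta> ^ m')\<^sup>2 * inner (B k *v s k) (s k)))"
    and x_next: "\<And>k. x (Suc k) = xb k + (\<tau> k)\<^sup>2 *\<^sub>R d k + \<tau> k *\<^sub>R s k"
    \<comment> \<open>convergence to a strong local minimizer with local smoothness\<close>
    and xb_lim: "xb \<longlonglongrightarrow> xs"
    and xs_slm: "strong_local_min (\<lambda>y. ereal (f y) + g y) xs"
    and f_C3: "\<exists>U. open U \<and> xs \<in> U \<and> C3_on U f"
    and prox_C1: "\<exists>U p. open U \<and> xs - \<gamma> *\<^sub>R Df xs \<in> U
                     \<and> (\<forall>z\<in>U. prox \<gamma> g z = {p z}) \<and> C1_on U p"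
    \<comment> \<open>Newton directions eventually\<close>
    and d_newton: "eventually (\<lambda>k. \<exists>v. GDERIV (fbe \<gamma> f Df g) (xb k) :> v
                       \<and> d k = - (matrix_inv (B k) *v v)) sequentially"
  shows "eventually (\<lambda>k. \<tau> k = 1) sequentially
         \<and> superlinear_conv x xs \<and> superlinear_conv xb xs \<and> superlinear_conv r 0"
proof -
  have Bss: "inner (B k *v s k) (s k) \<le> 0" for k
    using s_neg[of k] s_zero[of k] by fastforce
  have descent: "fbe \<gamma> f Df g (x (Suc k)) \<le> fbe \<gamma> f Df g (x k) - \<sigma> * (norm (r k))\<^sup>2" for k
    using backtracking_decrease[where \<Phi> = "\<lambda>t. fbe \<gamma> f Df g (xb k + t\<^sup>2 *\<^sub>R d k + t *\<^sub>R s k)",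
        OF ls[of k] Bss[of k]] \<mu>_bds x_next[of k] by simp
  have cost_le: "ereal (f (xb k)) + g (xb k) \<le> ereal (fbe \<gamma> f Df g (x k) - \<sigma> * (norm (r k))\<^sup>2)" for k
    using fb_sufficient_decrease[OF f_grad Df_lip g_proper \<gamma>_pos xb_sel[of k]] \<sigma>_bd by (simp add: r_def)
  have "ereal (f (xb k)) + g (xb k) \<le> ereal (fbe \<gamma> f Df g (x k))" for k
    using cost_le[of k] by (rule order_trans) (simp add: \<sigma>_pos less_imp_le)
  then have "r \<longlonglongrightarrow> 0"
    by (rule merit_descent_residual_tendsto_zero[where F = "\<lambda>k. fbe \<gamma> f Df g (x k)",
          OF descent \<sigma>_pos _ argmin_ne g_proper])
  then have x_lim: "x \<longlonglongrightarrow> xs"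
    using tendsto_add[OF xb_lim tendsto_scaleR[OF tendsto_const, of r 0 sequentially \<gamma>]] \<gamma>_pos
    by (simp add: r_def)
  have \<gamma>L: "\<gamma> * L < 1"
    using \<gamma>_L L_pos by (simp add: field_simps)
  obtain J p Jp where "fb_regular_point f Df L g \<gamma> xs J p Jp"
    using fb_regular_point_of_limit[OF f_grad Df_lip g_proper \<gamma>_pos \<gamma>L f_C3 prox_C1 xs_slm x_lim xb_lim xb_sel] .
  then interpret fb_regular_point f Df L g \<gamma> xs J p Jp .
  note newton = newton_direction_superlinear[OF xb_lim Q_sel P_sel B_def Bss d_newton]
  obtain \<eta> where "0 < \<eta>" and below: "eventually (\<lambda>y. \<forall>z. norm (z - xs) \<le> \<eta> * norm (y - xs)
      \<longrightarrow> ereal (fbe \<gamma> f Df g z) \<le> ereal (f y) + g y) (nhds xs)"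
    using eventually_fbe_below_cost by blast
  have unit_step: "eventually (\<lambda>k. \<tau> k = 1 \<and> x (Suc k) = xb k + d k) sequentially"
    using eventually_compose_filterlim[OF below xb_lim] landau_o.smallD[OF newton(2) \<open>0 < \<eta>\<close>] newton(1)
  proof eventually_elim
    case (elim k)
    then have "ereal (fbe \<gamma> f Df g (xb k + d k)) \<le> ereal (f (xb k)) + g (xb k)"
      by simp
    then have "fbe \<gamma> f Df g (xb k + d k) \<le> fbe \<gamma> f Df g (x k) - \<sigma> * (norm (r k))\<^sup>2"
      using cost_le[of k] by (metis ereal_less_eq(3) order_trans)
    then have "\<tau> k = 1"
      using elim(3) by (intro backtracking_unit_step[OF ls[of k]]) simp
    with elim(3) show ?case
      using x_next[of k] by simp
  qed
  then have "(\<lambda>k. norm (x (Suc k) - xs)) \<in> o(\<lambda>k. norm (xb k - xs))"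
    using newton(2) by (subst landau_o.small.in_cong) (auto elim: eventually_mono)
  from superlinear_conv_iterates_and_residuals[OF x_lim xb_lim r_def \<gamma>_pos this
      residual_error_bounds[OF x_lim xb_sel r_def]]
  show ?thesis
    using unit_step by (auto elim: eventually_mono)
qed

end
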